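(* Let $\Omega\subset\mathbb{C}^n$ be a bounded domain, let $p>1$, let $\varepsilon>0$, and let $S$ be a relatively compact subset of $\Omega$. Then there exists a constant $C=C(\varepsilon,S)$ such that for all $z',z,w\in S$, $$|m_p(z',z)-m_p(z',w)|\le C|z-w|^{1-\varepsilon}.$$ Moreover, the off-diagonal $p$-Bergman kernel $K_p(z,\cdot)$ is locally Hölder continuous of order $1-\varepsilon$ on $\Omega$: for every $z\in\Omega$, every $\varepsilon>0$ and every relatively compact subset $S$ of $\Omega$ there is a constant $C'$ such that $|K_p(z,w)-K_p(z,w')|\le C'|w-w'|^{1-\varepsilon}$ for all $w,w'\in S$.
   Context: For a bounded domain $\Omega\subset\mathbb{C}^n$ and $p>0$, $A^p(\Omega)$ is the space of holomorphic functions $f$ on $\Omega$ with $\|f\|_p=(\int_\Omega |f|^p)^{1/p}<\infty$ (Lebesgue measure). Put $$m_p(z)=\inf\{\|f\|_p: f\in A^p(\Omega),\ f(z)=1\}.$$ For $p\ge 1$ there is exactly one minimizer, denoted $m_p(\cdot,z)$; thus $m_p(\cdot,z)\in A^p(\Omega)$, $m_p(z,z)=1$ and $\|m_p(\cdot,z)\|_p=m_p(z)$, and $m_p(z',z)$ is the value of this minimizer at $z'$. The $p$-Bergman kernel is $K_p(z)=m_p(z)^{-p}$ and the off-diagonal $p$-Bergman kernel is $K_p(z,w)=m_p(z,w)K_p(w)$ for $p\ge1$. The domain $\Omega$ and the exponent $p$ are fixed, so constants may depend on them. *)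

theory Defs
  imports "HOL-Analysis.Analysis" "HOL-Library.FuncSet"
begin

text \<open>
  A function of several complex variables is holomorphic on an open set if its real
  Frechet derivative exists at every point of the set and is complex linear.
\<close>
definition holomorphic_Cn_on :: "(complex^'n \<Rightarrow> complex) \<Rightarrow> (complex^'n) set \<Rightarrow> bool" where
  "holomorphic_Cn_on f \<Omega> \<longleftrightarrow>
     (\<forall>z\<in>\<Omega>. \<exists>D. (f has_derivative D) (at z) \<and> (\<forall>c v. D (c *s v) = c * D v))"

definition Lp_norm :: "real \<Rightarrow> (complex^'n) set \<Rightarrow> (complex^'n \<Rightarrow> complex) \<Rightarrow> real" where
  "Lp_norm p \<Omega> f = (set_lebesgue_integral lebesgue \<Omega> (\<lambda>z. cmod (f z) powr p)) powr (1 / p)"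

text \<open>
  Functions on \<open>\<Omega>\<close> are represented by total functions that are \<open>undefined\<close> outside \<open>\<Omega>\<close>;
  otherwise a minimizer could not be unique as an element of the function type.
\<close>
definition Bergman_space :: "real \<Rightarrow> (complex^'n) set \<Rightarrow> (complex^'n \<Rightarrow> complex) set" where
  "Bergman_space p \<Omega> =
     {f \<in> extensional \<Omega>. holomorphic_Cn_on f \<Omega> \<and>
        set_integrable lebesgue \<Omega> (\<lambda>z. cmod (f z) powr p)}"

definition min_norm :: "real \<Rightarrow> (complex^'n) set \<Rightarrow> complex^'n \<Rightarrow> real" where
  "min_norm p \<Omega> z = Inf {Lp_norm p \<Omega> f | f. f \<in> Bergman_space p \<Omega> \<and> f z = 1}"

text \<open>
  \<open>minimizer p \<Omega> z' z\<close> is \<open>m\<^sub>p(z', z)\<close>: the base point of the extremal problem is the last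
  argument. The description is well defined for \<open>p \<ge> 1\<close> and \<open>z\<close> in a bounded domain \<open>\<Omega>\<close>.
\<close>
definition minimizer :: "real \<Rightarrow> (complex^'n) set \<Rightarrow> complex^'n \<Rightarrow> complex^'n \<Rightarrow> complex" where
  "minimizer p \<Omega> z' z =
     (THE f. f \<in> Bergman_space p \<Omega> \<and> f z = 1 \<and> Lp_norm p \<Omega> f = min_norm p \<Omega> z) z'"

definition Bergman_kernel_diag :: "real \<Rightarrow> (complex^'n) set \<Rightarrow> complex^'n \<Rightarrow> real" where
  "Bergman_kernel_diag p \<Omega> z = min_norm p \<Omega> z powr (- p)"

definition Bergman_kernel :: "real \<Rightarrow> (complex^'n) set \<Rightarrow> complex^'n \<Rightarrow> complex^'n \<Rightarrow> complex" where
  "Bergman_kernel p \<Omega> z w = minimizer p \<Omega> z w * of_real (Bergman_kernel_diag p \<Omega> w)"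

definition relatively_compact_in :: "'a::topological_space set \<Rightarrow> 'a set \<Rightarrow> bool" where
  "relatively_compact_in S \<Omega> \<longleftrightarrow> compact (closure S) \<and> closure S \<subseteq> \<Omega>"

end

theory Submission
  imports Defs "HOL-Complex_Analysis.Complex_Analysis"
begin

text \<open>
  Write \<open>f = m\<^sub>p(\<cdot>, z)\<close> and \<open>h = m\<^sub>p(\<cdot>, w)\<close>. Comparing \<open>f\<close> and \<open>h\<close> with the normalised
  midpoint \<open>(f + h) / 2\<close> bounds the convexity gap
  \<open>J = (\<parallel>f\<parallel>\<^sup>p + \<parallel>h\<parallel>\<^sup>p) / 2 - \<parallel>(f + h) / 2\<parallel>\<^sup>p\<close> by a combination of \<open>1 - Re h(z)\<close> and \<open>1 - Re f(w)\<close>.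
  This combination only involves the increments of \<open>f - h\<close> between \<open>z\<close> and \<open>w\<close> and a product of two
  Lipschitz differences, so \<open>J \<le> C (\<bar>z - w\<bar> A + \<bar>z - w\<bar>\<^sup>2)\<close> where \<open>A\<close> is a local supremum of \<open>\<bar>f - h\<bar>\<close>.
  Conversely \<open>A\<^sup>2 \<le> C J\<close>: the pointwise gap dominates \<open>\<bar>f - h\<bar>\<^sup>2\<close> wherever \<open>\<bar>f\<bar>\<close> is bounded below, in
  particular on circles avoiding the zeros of \<open>f\<close>, and the maximum principle fills in the rest.
  Hence \<open>A \<le> C \<bar>z - w\<bar>\<close>: the dependence on the base point is even locally Lipschitz.
\<close>

section \<open>Uniform convexity of the modulus to a power\<close>

text \<open>The estimate is fed into itself. Bounding 1 - Re h(z) and 1 - Re f(w) separately gives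
  only J = O(|z - w|), hence order 1/2 at best. Weighted by the minimal energies, the two terms
  combine into the minimal energy at w times Re((f - h)(z) - (f - h)(w)), plus the product of
  Lipschitz differences. By the Schwarz lemma for f - h the increment carries an extra factor A,
  which a lower bound for J of order A^2 turns into a quadratic inequality solvable for A. The
  exponent 2 there is decisive. Plain uniform convexity for p > 2 bounds J below only by |f - h|^p,
  and the same argument would stop at order 1/(p - 1). Hence the work on circles where |f| is
  bounded below. Such a bound must survive a move of the base point, so a qualitative continuity in
  the base point has to come before the sharp estimate; the crude bound J = O(|z - w|) supplies
  it.\<close>

definition midpoint_gap :: "real \<Rightarrow> complex \<Rightarrow> complex \<Rightarrow> real" where
  "midpoint_gap p a b = (cmod a powr p + cmod b powr p) / 2 - cmod ((a + b) / 2) powr p"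

text \<open>The parallelogram law, arranged so that |a - b|^2 / 4 is what averaging costs in squared
  modulus.\<close>

lemma cmod_midpoint_sq:
  "(cmod ((a + b) / 2))\<^sup>2 = ((cmod a)\<^sup>2 + (cmod b)\<^sup>2) / 2 - (cmod (a - b))\<^sup>2 / 4"
  unfolding norm_divide power_divide by (simp add: cmod_power2) (simp add: power2_eq_square field_simps)

text \<open>Lets the exponent act on squared moduli, the quantities that the parallelogram law
  controls. Negative \<open>x\<close> is covered because real \<open>powr\<close> is even in its
  base.\<close>

lemma powr_eq_square_powr_half: "x powr p = x\<^sup>2 powr (p / 2)" for x p :: real
proof -
  have "x\<^sup>2 = \<bar>x\<bar> powr 2" by simp
  then show ?thesis by (simp only: powr_powr) (simp add: abs_if uminus_powr_eq)
qed

text \<open>The tangent line of the p-th power at 1, evaluated at Re u. It replaces the nonlinear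
  |g(z)|^p by an expression affine in g(z), so that differences of extremal functions can be
  collected later.\<close>

lemma powr_ge_tangent_at_1:
  assumes "1 \<le> p"
  shows "1 + p * (Re u - 1) \<le> cmod u powr p"
proof (cases "Re u > 0")
  case True
  have "((\<lambda>x::real. x powr p) has_real_derivative p) (at 1 within {0<..})"
    by (auto intro!: derivative_eq_intros)
  then have "p * (Re u - 1) \<le> (Re u) powr p - 1 powr p"
    using True by (intro convex_on_imp_above_tangent[OF powr_convex[OF assms]]) (auto simp: interior_open)
  moreover have "(Re u) powr p \<le> cmod u powr p"
    using True assms by (intro powr_mono2) (auto simp: complex_Re_le_cmod)
  ultimately show ?thesis by simp
next
  case False
  then have "p * (Re u - 1) \<le> 1 * (-1)"
    using mult_mono[of 1 p 1 "1 - Re u"] assms by (simp add: algebra_simps)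
  then show ?thesis using powr_ge_zero[of "cmod u" p] by linarith
qed

text \<open>With \<open>A\<close> the mean of the squared moduli and e = |a - b|^2 / 4, the squared
  midpoint modulus is A - e. Then (1 - x)^r \<le> 1 - x for r = p / 2 \<ge> 1 extracts e * A^(r -
  1), convexity compares A^r with the mean p-th power, and \<open>A\<close> is at least the square
  of the mean modulus.\<close>

lemma midpoint_gap_ge_large:
  assumes p: "2 \<le> p"
  shows "(cmod (a - b))\<^sup>2 / 4 * ((cmod a + cmod b) / 2) powr (p - 2) \<le> midpoint_gap p a b"
proof (cases "a = 0 \<and> b = 0")
  case True
  then show ?thesis by (simp add: midpoint_gap_def)
next
  case False
  define s t where "s = cmod a" and "t = cmod b"
  define A where "A = (s\<^sup>2 + t\<^sup>2) / 2"
  define e where "e = (cmod (a - b))\<^sup>2 / 4"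
  define r where "r = p / 2"
  have r: "1 \<le> r" using p by (simp add: r_def)
  have A: "A > 0"
    using False by (auto simp: A_def s_def t_def sum_power2_gt_zero_iff intro!: divide_pos_pos)
  have B: "(cmod ((a + b) / 2))\<^sup>2 = A - e"
    by (simp only: cmod_midpoint_sq A_def e_def s_def t_def)
  have e0: "0 \<le> e" by (simp add: e_def)
  have eA: "e \<le> A" using B zero_le_power2[of "cmod ((a + b) / 2)"] by linarith
  have "(A - e) powr r = A powr r * (1 - e / A) powr r"
    using A by (subst powr_mult [symmetric]) (simp add: right_diff_distrib)
  also have "(1 - e / A) powr r \<le> (1 - e / A) powr 1"
    using r e0 eA A by (intro powr_mono') auto
  also have "\<dots> = 1 - e / A" using eA A by simp
  also have "A powr r * (1 - e / A) = A powr r - e * A powr (r - 1)"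
    using A by (simp add: powr_diff field_simps)
  finally have 1: "(A - e) powr r \<le> A powr r - e * A powr (r - 1)"
    by (simp add: mult_left_mono)
  have 2: "A powr r \<le> (s powr p + t powr p) / 2"
  proof (cases "s = 0 \<or> t = 0")
    case False
    then have "s > 0" "t > 0" by (auto simp: s_def t_def)
    then have "((1 - 1/2) * s\<^sup>2 + 1/2 * t\<^sup>2) powr r \<le> (1 - 1/2) * (s\<^sup>2) powr r + 1/2 * (t\<^sup>2) powr r"
      using convex_onD[OF powr_convex[OF r], of "1/2" "s\<^sup>2" "t\<^sup>2"] by simp
    then show ?thesis
      by (simp add: A_def s_def t_def powr_eq_square_powr_half[of _ p] r_def field_simps)
  next
    \<comment> \<open>\<open>powr_convex\<close> covers positive bases only. If one modulus is 0,
      the claim reduces to 2 \<le> 2 powr r.\<close>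
    case True
    have "(x\<^sup>2 / 2) powr r \<le> x powr p / 2" if "x \<ge> 0" for x :: real
    proof -
      have "(x\<^sup>2 / 2) powr r = x powr p / 2 powr r"
        using powr_eq_square_powr_half[of x p] by (simp add: powr_divide r_def)
      also have "\<dots> \<le> x powr p / 2"
        using powr_mono[of 1 r 2] r by (intro divide_left_mono) auto
      finally show ?thesis .
    qed
    from this[of s] this[of t] True show ?thesis
      using p by (auto simp: A_def s_def t_def)
  qed
  have "((s + t) / 2)\<^sup>2 \<le> A"
    using zero_le_power2[of "s - t"] by (simp add: A_def power2_eq_square field_simps)
  then have "(((s + t) / 2)\<^sup>2) powr (r - 1) \<le> A powr (r - 1)"
    using r by (intro powr_mono2) auto
  moreover have "((s + t) / 2)\<^sup>2 powr (r - 1) = ((s + t) / 2) powr (p - 2)"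
    using powr_eq_square_powr_half[of "(s + t) / 2" "p - 2"] by (simp add: r_def diff_divide_distrib)
  ultimately have 3: "e * ((s + t) / 2) powr (p - 2) \<le> e * A powr (r - 1)"
    using e0 by (simp add: mult_left_mono)
  have "cmod ((a + b) / 2) powr p = (A - e) powr r"
    by (simp only: powr_eq_square_powr_half[of _ p] B r_def)
  with 1 2 3 show ?thesis
    unfolding midpoint_gap_def e_def[symmetric] s_def[symmetric] t_def[symmetric] by linarith
qed

text \<open>For \<open>p < 2\<close> the function \<open>x\<^sup>p - \<kappa> x\<^sup>2\<close> is still convex and increasing on \<open>(0, M]\<close>.\<close>
lemma powr_minus_square_midpoint:
  fixes s t B M p :: real
  assumes p: "1 < p" "p < 2" and M: "0 < M"
    and st: "0 \<le> s" "s \<le> M" "0 \<le> t" "t \<le> M" and B: "0 \<le> B" "B \<le> (s + t) / 2"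
  defines "\<kappa> \<equiv> p * (p - 1) / 2 * M powr (p - 2)"
  shows "\<kappa> * ((s\<^sup>2 + t\<^sup>2) / 2 - B\<^sup>2) \<le> (s powr p + t powr p) / 2 - B powr p"
proof -
  define \<phi> where "\<phi> = (\<lambda>x::real. x powr p - \<kappa> * x\<^sup>2)"
  \<comment> \<open>2 * \<kappa> is the second derivative of x powr p at x = M, its smallest value
    on (0, M] because p < 2.\<close>
  have \<kappa>: "2 * \<kappa> \<le> p * (p - 1) * x powr (p - 2)" if "0 < x" "x \<le> M" for x
    using that p powr_mono2'[of "p - 2" x M] by (simp add: \<kappa>_def mult_left_mono)
  have conv: "convex_on {0<..M} \<phi>"
  proof (rule f''_ge0_imp_convex[where f' = "\<lambda>x. p * x powr (p - 1) - 2 * \<kappa> * x"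
        and f'' = "\<lambda>x. p * (p - 1) * x powr (p - 2) - 2 * \<kappa>"])
    fix x assume x: "x \<in> {0<..M}"
    show "(\<phi> has_real_derivative p * x powr (p - 1) - 2 * \<kappa> * x) (at x)"
      unfolding \<phi>_def using x by (auto intro!: derivative_eq_intros)
    show "((\<lambda>x. p * x powr (p - 1) - 2 * \<kappa> * x) has_real_derivative
        p * (p - 1) * x powr (p - 2) - 2 * \<kappa>) (at x)"
      using x by (auto intro!: derivative_eq_intros)
    show "0 \<le> p * (p - 1) * x powr (p - 2) - 2 * \<kappa>" using \<kappa> x by simp
  qed auto
  \<comment> \<open>Monotonicity lets \<open>B\<close> lie below the mean of \<open>s\<close> and
    \<open>t\<close>, as the modulus of a midpoint does. It rests on p - 1 \<le> 1, which bounds 2 *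
    \<kappa> * u by the derivative of u powr p.\<close>
  have mono: "\<phi> x \<le> \<phi> y" if xy: "0 < x" "x \<le> y" "y \<le> M" for x y
  proof (rule DERIV_nonneg_imp_nondecreasing[OF xy(2)])
    fix u assume u: "x \<le> u" "u \<le> y"
    have "p * (p - 1) * u powr (p - 2) \<le> p * 1 * u powr (p - 2)"
      using p by (intro mult_right_mono mult_left_mono) auto
    with \<kappa>[of u] u xy have "2 * \<kappa> \<le> p * u powr (p - 2)" by auto
    then have "2 * \<kappa> * u \<le> p * u powr (p - 2) * u" using u xy by (intro mult_right_mono) auto
    also have "\<dots> = p * u powr (p - 1)" using u xy powr_mult_base[of u "p - 2"] by (simp add: mult_ac)
    finally have "0 \<le> p * u powr (p - 1) - 2 * \<kappa> * u" by simp
    moreover have "(\<phi> has_real_derivative p * u powr (p - 1) - 2 * \<kappa> * u) (at u)"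
      unfolding \<phi>_def using u xy by (auto intro!: derivative_eq_intros)
    ultimately show "\<exists>y. (\<phi> has_real_derivative y) (at u) \<and> 0 \<le> y" by blast
  qed
  have pos: "\<phi> B \<le> (\<phi> s + \<phi> t) / 2"
    if "0 < s" "s \<le> M" "0 < t" "t \<le> M" "0 < B" "B \<le> (s + t) / 2" for s t B
  proof -
    have "\<phi> B \<le> \<phi> ((s + t) / 2)" using that by (intro mono) auto
    also have "\<dots> \<le> (\<phi> s + \<phi> t) / 2"
      using convex_onD[OF conv, of "1/2" s t] that by (simp add: field_simps)
    finally show ?thesis .
  qed
  \<comment> \<open>Zero values lie outside the interval of convexity; they are reached by replacing
    x with \<open>max x d\<close> and letting d tend to 0 from the right.\<close>
  have lim: "((\<lambda>d. \<phi> (max x d)) \<longlongrightarrow> \<phi> x) (at_right 0)" if "0 \<le> x" for x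
  proof -
    have "((\<lambda>d. max x d) \<longlongrightarrow> max x 0) (at_right 0)"
      by (intro tendsto_intros)
    then have *: "((\<lambda>d. max x d) \<longlongrightarrow> x) (at_right 0)"
      using that by (simp add: max_def)
    show ?thesis unfolding \<phi>_def
      by (rule tendsto_intros * | use that p in \<open>auto simp: eventually_at_filter\<close>)+
  qed
  have "\<phi> B \<le> (\<phi> s + \<phi> t) / 2"
  proof (rule tendsto_le[OF _ _ lim])
    show "((\<lambda>d. (\<phi> (max s d) + \<phi> (max t d)) / 2) \<longlongrightarrow> (\<phi> s + \<phi> t) / 2) (at_right 0)"
      by (intro tendsto_intros lim st) auto
    have "eventually (\<lambda>d. d \<in> {0<..<M}) (at_right (0::real))"
      using M eventually_at_right_field by (auto simp: eventually_at_right_field)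
    then show "eventually (\<lambda>d. \<phi> (max B d) \<le> (\<phi> (max s d) + \<phi> (max t d)) / 2) (at_right 0)"
      by eventually_elim (use st B in \<open>intro pos, auto simp: max_def\<close>)
  qed (use B in auto)
  then show ?thesis by (simp add: \<phi>_def field_simps)
qed

text \<open>The parallelogram law turns the difference of squares in
  \<open>powr_minus_square_midpoint\<close> into |a - b|^2 / 4, whence the 8 in the
  constant.\<close>

lemma midpoint_gap_ge_small:
  assumes p: "1 < p" "p < 2" and M: "0 < M" "cmod a \<le> M" "cmod b \<le> M"
  shows "p * (p - 1) / 8 * M powr (p - 2) * (cmod (a - b))\<^sup>2 \<le> midpoint_gap p a b"
proof -
  have "cmod ((a + b) / 2) \<le> (cmod a + cmod b) / 2"
    using norm_triangle_ineq[of a b] by (simp add: norm_divide)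
  from powr_minus_square_midpoint[OF p M(1) _ M(2) _ M(3) _ this]
  show ?thesis
    unfolding cmod_midpoint_sq midpoint_gap_def by (simp add: field_simps)
qed

text \<open>The crude form: for p \<ge> 2 the triangle inequality replaces the mean modulus by |a -
  b| / 2, at the price of the exponent \<open>p\<close>. It holds through zeros and suffices where
  only convergence, uniqueness or continuity is at stake.\<close>

lemma midpoint_gap_ge_power:
  assumes p: "1 < p" and M: "0 < M"
  shows "\<exists>c>0. \<forall>a b. cmod a \<le> M \<longrightarrow> cmod b \<le> M \<longrightarrow> c * cmod (a - b) powr max 2 p \<le> midpoint_gap p a b"
proof (cases "p < 2")
  case True
  then show ?thesis
    using midpoint_gap_ge_small[OF p True M] p M
    by (intro exI[of _ "p * (p - 1) / 8 * M powr (p - 2)"]) (auto simp: max_def)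
next
  case False
  have "(1/2) powr p * cmod (a - b) powr p \<le> midpoint_gap p a b" for a b
  proof -
    have "(1/2) powr p * cmod (a - b) powr p = (cmod (a - b) / 2) powr (2 + (p - 2))"
      by (simp add: powr_divide)
    also have "\<dots> = (cmod (a - b))\<^sup>2 / 4 * (cmod (a - b) / 2) powr (p - 2)"
      by (simp only: powr_add) (simp add: power2_eq_square)
    also have "\<dots> \<le> (cmod (a - b))\<^sup>2 / 4 * ((cmod a + cmod b) / 2) powr (p - 2)"
      using False norm_triangle_ineq4[of a b] by (intro mult_left_mono powr_mono2) auto
    also have "\<dots> \<le> midpoint_gap p a b" using midpoint_gap_ge_large False by simp
    finally show ?thesis .
  qed
  then show ?thesis using False
    by (intro exI[of _ "(1/2) powr p"]) (auto simp: max_def)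
qed

text \<open>For p \<ge> 2 only the weight ((|a| + |b|) / 2) powr (p - 2) obstructs a quadratic
  bound, and a lower bound \<eta> on one argument controls it.\<close>

lemma midpoint_gap_ge_square:
  assumes p: "1 < p" and M: "0 < M" and \<eta>: "0 < \<eta>"
  shows "\<exists>c>0. \<forall>a b. cmod a \<le> M \<longrightarrow> cmod b \<le> M \<longrightarrow> \<eta> \<le> cmod a \<longrightarrow>
            c * (cmod (a - b))\<^sup>2 \<le> midpoint_gap p a b"
proof (cases "p < 2")
  case True
  then show ?thesis
    using midpoint_gap_ge_small[OF p True M] p M
    by (intro exI[of _ "p * (p - 1) / 8 * M powr (p - 2)"]) auto
next
  case False
  have "(\<eta> / 2) powr (p - 2) / 4 * (cmod (a - b))\<^sup>2 \<le> midpoint_gap p a b" if "\<eta> \<le> cmod a" for a b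
  proof -
    have "(\<eta> / 2) powr (p - 2) \<le> ((cmod a + cmod b) / 2) powr (p - 2)"
      using that \<eta> False norm_ge_zero[of b] by (intro powr_mono2) (simp_all del: norm_ge_zero)
    then have "(cmod (a - b))\<^sup>2 / 4 * (\<eta> / 2) powr (p - 2) \<le> (cmod (a - b))\<^sup>2 / 4 * ((cmod a + cmod b) / 2) powr (p - 2)"
      by (intro mult_left_mono) auto
    also have "\<dots> \<le> midpoint_gap p a b" using midpoint_gap_ge_large False by simp
    finally show ?thesis by (simp add: mult_ac)
  qed
  then show ?thesis using \<eta>
    by (intro exI[of _ "(\<eta> / 2) powr (p - 2) / 4"]) auto
qed

lemma midpoint_gap_nonneg:
  assumes "1 < p"
  shows "0 \<le> midpoint_gap p a b"
proof -
  obtain c where "c > 0" "c * cmod (a - b) powr max 2 p \<le> midpoint_gap p a b"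
    using midpoint_gap_ge_power[OF assms, of "1 + cmod a + cmod b"] norm_ge_zero[of a] norm_ge_zero[of b]
    by (smt (verit))
  then show ?thesis
    by (smt (verit) mult_nonneg_nonneg powr_ge_zero)
qed

section \<open>Holomorphic functions of several variables\<close>

lemma norm_vector_smult: "norm (c *s v) = cmod c * norm v" for v :: "complex^'n"
  by (simp add: norm_vec_def norm_mult L2_set_right_distrib)

lemma has_derivative_smult_left: "((\<lambda>t. t *s v) has_derivative (\<lambda>t. t *s v)) F"
  for v :: "complex^'n"
proof -
  have "linear (\<lambda>t::complex. t *s v)"
    by (rule linearI) (simp_all add: vec_eq_iff algebra_simps)
  then show ?thesis
    by (intro bounded_linear_imp_has_derivative) (simp add: linear_conv_bounded_linear)
qed

lemma holomorphic_Cn_on_imp_continuous_on: "holomorphic_Cn_on f S \<Longrightarrow> continuous_on S f"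
  unfolding holomorphic_Cn_on_def
  by (meson continuous_at_imp_continuous_on has_derivative_continuous)

lemma holomorphic_Cn_on_subset: "holomorphic_Cn_on f S \<Longrightarrow> T \<subseteq> S \<Longrightarrow> holomorphic_Cn_on f T"
  unfolding holomorphic_Cn_on_def by blast

lemma holomorphic_Cn_on_const: "holomorphic_Cn_on (\<lambda>_. c) S"
  unfolding holomorphic_Cn_on_def by (auto intro!: exI[of _ "\<lambda>_. 0"])

lemma holomorphic_Cn_on_cmult:
  assumes "holomorphic_Cn_on f S"
  shows "holomorphic_Cn_on (\<lambda>z. c * f z) S"
  unfolding holomorphic_Cn_on_def
proof
  fix z assume "z \<in> S"
  then obtain D where "(f has_derivative D) (at z)" "\<And>c v. D (c *s v) = c * D v"
    using assms unfolding holomorphic_Cn_on_def by blast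
  then show "\<exists>D. ((\<lambda>z. c * f z) has_derivative D) (at z) \<and> (\<forall>c v. D (c *s v) = c * D v)"
    by (intro exI[of _ "\<lambda>v. c * D v"]) (auto intro!: derivative_eq_intros)
qed

lemma holomorphic_Cn_on_add:
  assumes "holomorphic_Cn_on f S" "holomorphic_Cn_on g S"
  shows "holomorphic_Cn_on (\<lambda>z. f z + g z) S"
  unfolding holomorphic_Cn_on_def
proof
  fix z assume "z \<in> S"
  then obtain D E where "(f has_derivative D) (at z)" "\<And>c v. D (c *s v) = c * D v"
    "(g has_derivative E) (at z)" "\<And>c v. E (c *s v) = c * E v"
    using assms unfolding holomorphic_Cn_on_def by meson
  then show "\<exists>D. ((\<lambda>z. f z + g z) has_derivative D) (at z) \<and> (\<forall>c v. D (c *s v) = c * D v)"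
    by (intro exI[of _ "\<lambda>v. D v + E v"]) (auto intro!: derivative_eq_intros simp: algebra_simps)
qed

lemma holomorphic_Cn_on_diff:
  assumes "holomorphic_Cn_on f S" "holomorphic_Cn_on g S"
  shows "holomorphic_Cn_on (\<lambda>z. f z - g z) S"
  using holomorphic_Cn_on_add[OF assms(1) holomorphic_Cn_on_cmult[OF assms(2), of "-1"]] by simp

lemma holomorphic_Cn_on_cong:
  assumes "open S" "\<And>z. z \<in> S \<Longrightarrow> f z = g z" "holomorphic_Cn_on f S"
  shows "holomorphic_Cn_on g S"
  using assms unfolding holomorphic_Cn_on_def
  by (meson has_derivative_transform_within_open)

text \<open>The clause \<open>D (c *s v) = c * D v\<close> turns the real derivative along a complex
  line into a complex one; through such lines the one-variable library becomes available.\<close>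

lemma has_field_derivative_line:
  fixes f :: "complex^'n \<Rightarrow> complex"
  assumes D: "(f has_derivative D) (at (a + t *s v))" "\<And>c v. D (c *s v) = c * D v"
  shows "((\<lambda>t. f (a + t *s v)) has_field_derivative D v) (at t)"
proof -
  have "((\<lambda>t. a + t *s v) has_derivative (\<lambda>t. t *s v)) (at t)"
    by (rule has_derivative_eq_rhs, rule has_derivative_add[OF has_derivative_const has_derivative_smult_left]) simp
  from has_derivative_compose[OF this D(1)] show ?thesis
    by (simp add: has_field_derivative_def D(2) mult_commute_abs)
qed

lemma holomorphic_on_line:
  fixes f :: "complex^'n \<Rightarrow> complex"
  assumes "holomorphic_Cn_on f S" "open T" "\<And>t. t \<in> T \<Longrightarrow> a + t *s v \<in> S"
  shows "(\<lambda>t. f (a + t *s v)) holomorphic_on T"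
  unfolding holomorphic_on_open[OF assms(2)]
proof
  fix t assume "t \<in> T"
  then obtain D where "(f has_derivative D) (at (a + t *s v))" "\<And>c v. D (c *s v) = c * D v"
    using assms unfolding holomorphic_Cn_on_def by meson
  from has_field_derivative_line[OF this]
  show "\<exists>f'. ((\<lambda>t. f (a + t *s v)) has_field_derivative f') (at t)" ..
qed

text \<open>The one-variable Schwarz lemma on the complex line through \<open>a\<close> and
  \<open>x\<close>, applied to (f - f a) / (2 * M), which maps the unit disc to itself and 0 to
  0.\<close>

lemma Schwarz_Cn:
  fixes f :: "complex^'n \<Rightarrow> complex"
  assumes hol: "holomorphic_Cn_on f (ball a r)" and bd: "\<And>x. x \<in> ball a r \<Longrightarrow> cmod (f x) \<le> M"
    and x: "x \<in> ball a r"
  shows "cmod (f x - f a) \<le> 2 * M / r * norm (x - a)"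
proof (cases "x = a")
  case False
  define d where "d = norm (x - a)"
  have d: "0 < d" "d < r" using False x by (auto simp: d_def dist_norm norm_minus_commute)
  then have r: "0 < r" by simp
  have M: "0 \<le> M" using bd[of a] r norm_ge_zero[of "f a"] by (simp del: norm_ge_zero)
  define v where "v = of_real (r / d) *s (x - a)"
  have v: "norm v = r" 
    unfolding v_def norm_vector_smult d_def[symmetric] using d r by (simp add: norm_divide)
  have in_ball: "a + t *s v \<in> ball a r" if "cmod t < 1" for t
    using that r by (simp add: dist_norm norm_vector_smult v)
  \<comment> \<open>\<open>Schwarz_Lemma\<close> wants values strictly inside the unit disc, so
    \<open>M\<close> is enlarged to M' and then M' decreases to \<open>M\<close>.\<close>
  have "cmod (f x - f a) * r / (2 * d) \<le> M'" if M': "M < M'" for M'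
  proof -
    define g where "g = (\<lambda>t. (f (a + t *s v) - f a) / (2 * M'))"
    have "g holomorphic_on ball 0 1"
      unfolding g_def using M M' in_ball
      by (intro holomorphic_intros holomorphic_on_line[OF hol]) auto
    moreover have "g 0 = 0" by (simp add: g_def)
    moreover have "norm (g z) < 1" if "norm z < 1" for z
    proof -
      have "cmod (f (a + z *s v) - f a) \<le> M + M"
        using bd[OF in_ball[OF that]] bd[of a] r norm_triangle_ineq4[of "f (a + z *s v)" "f a"]
        by (simp del: norm_triangle_ineq4)
      then show ?thesis using M M' by (simp add: g_def norm_divide norm_mult)
    qed
    moreover have "norm (complex_of_real (d / r)) < 1" using d by (simp add: norm_divide)
    ultimately have "norm (g (of_real (d / r))) \<le> norm (complex_of_real (d / r))"
      by (rule Schwarz_Lemma(1))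
    moreover have "a + of_real (d / r) *s v = x"
      using d r by (simp add: v_def vec_eq_iff)
    ultimately show ?thesis
      using d r M M' by (simp add: g_def norm_divide norm_mult field_simps)
  qed
  then have "cmod (f x - f a) * r / (2 * d) \<le> M" by (rule dense_ge)
  then show ?thesis using d r by (simp add: d_def[symmetric] field_simps)
qed simp

section \<open>Point values bounded by integrals\<close>

lemma integral_ge_const_times_measure:
  fixes h :: "'a::euclidean_space \<Rightarrow> real"
  assumes B: "B \<in> lmeasurable" "B \<subseteq> \<Omega>" and h: "set_integrable lebesgue \<Omega> h"
    and nn: "\<And>x. x \<in> \<Omega> \<Longrightarrow> 0 \<le> h x" and K: "\<And>x. x \<in> B \<Longrightarrow> K \<le> h x"
  shows "K * measure lebesgue B \<le> (LINT x:\<Omega>|lebesgue. h x)"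
proof -
  have "K * measure lebesgue B = (LINT x|lebesgue. K * indicator B x)"
    using B by simp
  also have "\<dots> \<le> (LINT x|lebesgue. indicator \<Omega> x *\<^sub>R h x)"
  proof (rule integral_mono)
    show "integrable lebesgue (\<lambda>x. K * indicator B x)"
      using B by (intro integrable_mult_right) (auto simp: fmeasurable_def)
    show "integrable lebesgue (\<lambda>x. indicator \<Omega> x *\<^sub>R h x)"
      using h by (simp add: set_integrable_def)
    show "K * indicator B x \<le> indicator \<Omega> x *\<^sub>R h x" for x
      using B K[of x] nn[of x] by (auto simp: indicator_def)
  qed
  finally show ?thesis by (simp add: set_lebesgue_integral_def)
qed

text \<open>No mean value property is used: at a maximum of \<open>\<bar>f x\<bar> (R - \<bar>x - a\<bar>)\<^sup>k\<close> the Schwarz lemma keeps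
  \<open>\<bar>f\<bar>\<close> above half its value on a ball of radius proportional to \<open>R - \<bar>x - a\<bar>\<close>, and \<open>k = dim / q\<close>
  makes the volume of that ball cancel the weight.\<close>
lemma point_value_le_integral:
  fixes r q :: real
  assumes r: "r > 0" and q: "q > 0"
  obtains C where "C > 0" "\<And>(f :: complex^'n \<Rightarrow> complex) a c h \<Omega>.
    \<lbrakk>holomorphic_Cn_on f (ball a r); ball a r \<subseteq> \<Omega>; 0 \<le> c;
    set_integrable lebesgue \<Omega> h; \<forall>x\<in>\<Omega>. 0 \<le> h x;
    \<forall>x\<in>ball a r. c * cmod (f x) powr q \<le> h x\<rbrakk> \<Longrightarrow>
    c * cmod (f a) powr q \<le> C * (LINT x:\<Omega>|lebesgue. h x)"
proof -
  define d where "d = DIM(complex^'n)"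
  have d0: "0 < d" by (simp add: d_def)
  define k where "k = real d / q"
  have k: "0 < k" using d0 q by (simp add: k_def)
  \<comment> \<open>The closed ball of half the radius is compact and inside the ball of holomorphy,
    so the weighted modulus attains its maximum on it.\<close>
  define R where "R = r / 2"
  have R: "0 < R" using r by (simp add: R_def)
  \<comment> \<open>Chosen so that 4 * 2 powr k * \<delta> = 1 / 2, the relative variation of
    \<open>f\<close> that the Schwarz lemma allows on
    \<open>ball x0 (\<delta> * \<rho>)\<close>.\<close>
  define \<delta> where "\<delta> = 2 powr (- (k + 3))"
  have \<delta>: "0 < \<delta>" by (simp add: \<delta>_def)
  have "\<delta> \<le> 2 powr (-3)" unfolding \<delta>_def using k by (intro powr_mono) auto
  then have \<delta>8: "\<delta> \<le> 1 / 8" by (simp add: powr_minus)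
  define V where "V = measure lebesgue (ball (0 :: complex^'n) 1)"
  have V: "0 < V" using content_ball_pos[of 1 "0 :: complex^'n"] by (simp add: V_def)
  define L where "L = R ^ d * (1/2) powr q * V * \<delta> ^ d"
  have L: "0 < L" using R V \<delta> by (simp add: L_def)
  have main: "c * cmod (f a) powr q * L \<le> (LINT x:\<Omega>|lebesgue. h x)"
    if hol: "holomorphic_Cn_on f (ball a r)" and sub: "ball a r \<subseteq> \<Omega>" and c: "0 \<le> c"
      and h: "set_integrable lebesgue \<Omega> h" "\<forall>x\<in>\<Omega>. 0 \<le> h x"
      and le: "\<forall>x\<in>ball a r. c * cmod (f x) powr q \<le> h x"
    for f :: "complex^'n \<Rightarrow> complex" and a c h \<Omega>
  proof (cases "f a = 0")
    case True
    then show ?thesis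
      using h(2) by (simp add: set_lebesgue_integral_def) (intro Bochner_Integration.integral_nonneg, auto simp: indicator_def)
  next
    case False
    define W where "W = (\<lambda>x. R - norm (x - a))"
    have cb: "cball a R \<subseteq> ball a r" using r by (auto simp: R_def)
    have cont: "continuous_on (cball a R) f"
      using holomorphic_Cn_on_imp_continuous_on[OF hol] cb continuous_on_subset by blast
    have "continuous_on (cball a R) (\<lambda>x. cmod (f x) * W x powr k)"
      unfolding W_def using k
      by (intro continuous_on_mult continuous_on_norm cont continuous_on_powr' continuous_intros)
         (auto simp: dist_norm norm_minus_commute)
    then obtain x0 where x0: "x0 \<in> cball a R"
      and max: "\<And>x. x \<in> cball a R \<Longrightarrow> cmod (f x) * W x powr k \<le> cmod (f x0) * W x0 powr k"
      using continuous_attains_sup[of "cball a R" "\<lambda>x. cmod (f x) * W x powr k"] R by auto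
    define F where "F = cmod (f x0)"
    define \<rho> where "\<rho> = W x0"
    have a: "cmod (f a) * R powr k \<le> F * \<rho> powr k"
      using max[of a] R by (simp add: W_def F_def \<rho>_def)
    moreover have "0 < cmod (f a) * R powr k" using False R by simp
    ultimately have "0 < F * \<rho> powr k" by linarith
    then have F: "0 < F" and "\<rho> \<noteq> 0"
      using zero_less_mult_iff[of F "\<rho> powr k"] powr_ge_zero[of \<rho> k]  by (auto simp: F_def)
    moreover have "0 \<le> \<rho>" using x0 by (simp add: \<rho>_def W_def dist_norm norm_minus_commute)
    ultimately have \<rho>: "0 < \<rho>" by simp
    have inb: "x \<in> cball a R" "\<rho> / 2 \<le> W x" if "x \<in> ball x0 (\<rho> / 2)" for x
    proof -
      have "norm (x - a) \<le> norm (x - x0) + norm (x0 - a)"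
        using norm_triangle_ineq[of "x - x0" "x0 - a"] by simp
      moreover have "norm (x - x0) < \<rho> / 2" using that by (simp add: dist_norm norm_minus_commute)
      ultimately show "\<rho> / 2 \<le> W x" by (simp add: W_def \<rho>_def)
      then show "x \<in> cball a R" using \<rho> by (simp add: W_def dist_norm norm_minus_commute)
    qed
    \<comment> \<open>On this ball the weight is at least (\<rho> / 2) powr k, so maximality at
      \<open>x0\<close> costs only a factor 2 powr k.\<close>
    have bd: "cmod (f x) \<le> 2 powr k * F" if "x \<in> ball x0 (\<rho> / 2)" for x
    proof -
      have "cmod (f x) * (\<rho> / 2) powr k \<le> cmod (f x) * W x powr k"
        using inb[OF that] k \<rho> by (intro mult_left_mono powr_mono2) auto
      also have "\<dots> \<le> F * \<rho> powr k" using max[OF inb(1)[OF that]] by (simp add: F_def \<rho>_def)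
      finally show ?thesis using \<rho> by (simp add: powr_divide field_simps)
    qed
    have sub1: "ball x0 (\<rho> / 2) \<subseteq> ball a r" using inb(1) cb by blast
    have sub2: "ball x0 (\<delta> * \<rho>) \<subseteq> ball x0 (\<rho> / 2)"
      using \<delta>8 \<rho> by (intro subset_ball) simp
    have low: "F / 2 \<le> cmod (f x)" if x: "x \<in> ball x0 (\<delta> * \<rho>)" for x
    proof -
      have "cmod (f x - f x0) \<le> 2 * (2 powr k * F) / (\<rho> / 2) * norm (x - x0)"
        using holomorphic_Cn_on_subset[OF hol sub1] bd x sub2 by (intro Schwarz_Cn) auto
      also have "\<dots> \<le> 2 * (2 powr k * F) / (\<rho> / 2) * (\<delta> * \<rho>)"
        using x F \<rho> by (intro mult_left_mono) (auto simp: dist_norm norm_minus_commute)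
      also have "\<dots> = 4 * F * (2 powr k * \<delta>)" using \<rho> by simp
      also have "2 powr k * \<delta> = 1 / 8"
        by (simp add: \<delta>_def powr_add[symmetric] powr_minus)
      finally show ?thesis using norm_triangle_ineq2[of "f x0" "f x"]
        by (simp add: F_def norm_minus_commute)
    qed
    have "c * (F / 2) powr q * measure lebesgue (ball x0 (\<delta> * \<rho>)) \<le> (LINT x:\<Omega>|lebesgue. h x)"
    proof (rule integral_ge_const_times_measure)
      fix x assume x: "x \<in> ball x0 (\<delta> * \<rho>)"
      have "c * (F / 2) powr q \<le> c * cmod (f x) powr q"
        using low[OF x] c q F by (intro mult_left_mono powr_mono2) auto
      also have "\<dots> \<le> h x" using le x sub1 sub2 by blast
      finally show "c * (F / 2) powr q \<le> h x" .
    qed (use sub sub1 sub2 h in auto)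
    moreover have "measure lebesgue (ball x0 (\<delta> * \<rho>)) = (\<delta> * \<rho>) ^ d * V"
      using content_ball_conv_unit_ball[of "\<delta> * \<rho>" x0] \<delta> \<rho> by (simp add: d_def V_def)
    \<comment> \<open>Since k * q = d, the maximality inequality at \<open>a\<close> raised to the
      power \<open>q\<close> has \<rho> ^ d on its right side, the same factor as the volume of the
      small ball; the unknown \<rho> disappears.\<close>
    moreover have "cmod (f a) powr q * R ^ d \<le> F powr q * \<rho> ^ d"
    proof -
      have kq: "(y powr k) powr q = y ^ d" if "0 < y" for y
        using that q by (simp add: powr_powr k_def powr_realpow)
      have "(cmod (f a) * R powr k) powr q \<le> (F * \<rho> powr k) powr q"
        using a q R by (intro powr_mono2) auto
      then show ?thesis using R \<rho> by (simp add: powr_mult kq)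
    qed
    then have "c * (cmod (f a) powr q * R ^ d) * ((1/2) powr q * V * \<delta> ^ d)
        \<le> c * (F powr q * \<rho> ^ d) * ((1/2) powr q * V * \<delta> ^ d)"
      using c V \<delta> by (intro mult_right_mono mult_left_mono) auto
    ultimately show ?thesis
      by (simp add: L_def powr_divide power_mult_distrib mult_ac)
  qed
  show thesis
  proof (rule that[of "1 / L"], goal_cases)
    case (2 f a c h \<Omega>)
    from main[OF 2] show ?case using L by (simp add: field_simps)
  qed (use L in auto)
qed

section \<open>Cauchy estimate and locally uniform limits\<close>

lemma derivative_bound_Cn:
  fixes f :: "complex^'n \<Rightarrow> complex"
  assumes hol: "holomorphic_Cn_on f (ball a r)" and bd: "\<And>x. x \<in> ball a r \<Longrightarrow> cmod (f x) \<le> M"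
    and r: "0 < r" and D: "(f has_derivative D) (at a)" "\<And>c v. D (c *s v) = c * D v"
  shows "cmod (D v) \<le> 2 * M / r * norm v"
proof -
  have "((\<lambda>t. f (a + t *s v)) has_field_derivative D v) (at 0)"
    by (rule has_field_derivative_line) (use D in auto)
  then have lim: "((\<lambda>t. (f (a + t *s v) - f a) / t) \<longlongrightarrow> D v) (at 0)"
    by (simp add: has_field_derivative_iff)
  have "isCont (\<lambda>t. a + t *s v) 0"
    using has_derivative_continuous[OF has_derivative_add[OF has_derivative_const has_derivative_smult_left]] .
  then have "((\<lambda>t. a + t *s v) \<longlongrightarrow> a) (at 0)"
    by (simp add: isCont_def)
  then have "eventually (\<lambda>t. a + t *s v \<in> ball a r) (at 0)"
    using r topological_tendstoD[of _ a "at 0" "ball a r"] by simp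
  then have "eventually (\<lambda>t. cmod ((f (a + t *s v) - f a) / t) \<le> 2 * M / r * norm v) (at 0)"
    using eventually_neq_at_within[of 0]
  proof eventually_elim
    case (elim t)
    from Schwarz_Cn[OF hol bd elim(1)] elim(2) show ?case
      by (simp add: norm_vector_smult norm_divide field_simps)
  qed
  from Lim_norm_ubound[OF _ lim this] show ?thesis by simp
qed

text \<open>The Cauchy estimate for differences f m - f n makes the derivatives uniformly Cauchy
  near each point; termwise differentiation then applies, and complex linearity survives pointwise
  limits.\<close>

lemma holomorphic_Cn_on_locally_uniform_limit:
  fixes f :: "nat \<Rightarrow> complex^'n \<Rightarrow> complex"
  assumes S: "open S" and hol: "\<And>n. holomorphic_Cn_on (f n) S"
    and lim: "\<And>a. a \<in> S \<Longrightarrow> \<exists>r>0. uniform_limit (ball a r) f g sequentially"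
  shows "holomorphic_Cn_on g S"
  unfolding holomorphic_Cn_on_def
proof
  fix a assume a: "a \<in> S"
  obtain r1 where r1: "0 < r1" "uniform_limit (ball a r1) f g sequentially" using lim[OF a] by blast
  obtain r2 where r2: "0 < r2" "ball a r2 \<subseteq> S" using S a open_contains_ball by blast
  \<comment> \<open>Halving leaves, around every point of \<open>ball a s\<close>, a ball of the
    fixed radius \<open>s\<close> for the Cauchy estimate.\<close>
  define s where "s = min r1 r2 / 2"
  have s: "0 < s" using r1 r2 by (simp add: s_def)
  have sub: "ball x s \<subseteq> S" "ball x s \<subseteq> ball a r1" if "x \<in> ball a s" for x
  proof -
    have "ball x s \<subseteq> ball a (min r1 r2)"
    proof
      fix y assume "y \<in> ball x s"
      then have "dist a y < min r1 r2"
        using that dist_triangle[of a y x] unfolding s_def mem_ball by linarith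
      then show "y \<in> ball a (min r1 r2)" by simp
    qed
    moreover have "ball a (min r1 r2) \<subseteq> ball a r1" "ball a (min r1 r2) \<subseteq> ball a r2"
      by (simp_all add: subset_ball)
    ultimately show "ball x s \<subseteq> S" "ball x s \<subseteq> ball a r1" using r2 by blast+
  qed
  have inS: "x \<in> S" if "x \<in> ball a s" for x using sub(1)[OF that] s by auto
  have "\<forall>n x. \<exists>D. x \<in> S \<longrightarrow> (f n has_derivative D) (at x) \<and> (\<forall>c v. D (c *s v) = c * D v)"
    using hol unfolding holomorphic_Cn_on_def by blast
  then obtain D where D: "\<And>n x. x \<in> S \<Longrightarrow> (f n has_derivative D n x) (at x)"
    "\<And>n x c v. x \<in> S \<Longrightarrow> D n x (c *s v) = c * D n x v"
    by metis
  have cauchy: "\<exists>N. \<forall>m\<ge>N. \<forall>n\<ge>N. \<forall>x\<in>ball a s. \<forall>v. cmod (D m x v - D n x v) \<le> e * norm v"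
    if e: "0 < e" for e
  proof -
    have "uniformly_Cauchy_on (ball a r1) f"
      using r1(2) uniformly_convergent_Cauchy uniformly_convergent_on_def by blast
    moreover have "0 < e * s / 2" using e s by simp
    ultimately obtain N where
      N: "\<And>x m n. x \<in> ball a r1 \<Longrightarrow> m \<ge> N \<Longrightarrow> n \<ge> N \<Longrightarrow> cmod (f m x - f n x) < e * s / 2"
      unfolding uniformly_Cauchy_on_def dist_norm by meson
    have "cmod (D m x v - D n x v) \<le> 2 * (e * s / 2) / s * norm v"
      if "m \<ge> N" "n \<ge> N" "x \<in> ball a s" for m n x v
    proof (rule derivative_bound_Cn)
      show "holomorphic_Cn_on (\<lambda>x. f m x - f n x) (ball x s)"
        using hol sub that by (blast intro: holomorphic_Cn_on_diff holomorphic_Cn_on_subset)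
      show "cmod (f m y - f n y) \<le> e * s / 2" if "y \<in> ball x s" for y
        using N[of y m n] sub(2)[OF \<open>x \<in> ball a s\<close>] that \<open>m \<ge> N\<close> \<open>n \<ge> N\<close>
        by (meson less_imp_le subsetD)
      show "((\<lambda>x. f m x - f n x) has_derivative (\<lambda>v. D m x v - D n x v)) (at x)"
        using D inS that by (intro has_derivative_diff) auto
    qed (use D inS that s in \<open>auto simp: algebra_simps\<close>)
    then show ?thesis using s by (intro exI[of _ N]) simp
  qed
  define g' where "g' = (\<lambda>x v. lim (\<lambda>n. D n x v))"
  have g': "(\<lambda>n. D n x v) \<longlonglongrightarrow> g' x v" if x: "x \<in> ball a s" for x v
  proof -
    have "Cauchy (\<lambda>n. D n x v)"
    proof (rule CauchyI)
      fix e :: real assume e: "0 < e"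
      define e' where "e' = e / (2 * (norm v + 1))"
      have e': "0 < e'" using e add_nonneg_pos[OF norm_ge_zero[of v], of 1] by (simp add: e'_def)
      obtain N where N: "\<forall>m\<ge>N. \<forall>n\<ge>N. \<forall>x\<in>ball a s. \<forall>v. cmod (D m x v - D n x v) \<le> e' * norm v"
        using cauchy[OF e'] by blast
      have "norm v < 2 * (norm v + 1)" by (smt (verit) norm_ge_zero)
      then have "e' * norm v < e' * (2 * (norm v + 1))"
        by (rule mult_strict_left_mono[OF _ e'])
      also have "\<dots> = e"
        using add_nonneg_pos[OF norm_ge_zero[of v], of 1] by (simp add: e'_def)
      finally have "e' * norm v < e" .
      with N x show "\<exists>M. \<forall>m\<ge>M. \<forall>n\<ge>M. norm (D m x v - D n x v) < e"
        by (meson order.strict_trans1)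
    qed
    then show ?thesis
      unfolding g'_def by (simp add: Cauchy_convergent_iff convergent_LIMSEQ_iff)
  qed
  have "\<exists>g2. \<forall>x\<in>ball a s. (\<lambda>n. f n x) \<longlonglongrightarrow> g2 x \<and> (g2 has_derivative g' x) (at x within ball a s)"
  proof (rule has_derivative_sequence)
    show "(f n has_derivative D n x) (at x within ball a s)" if "x \<in> ball a s" for n x
      using D(1) inS that by (blast intro: has_derivative_at_withinI)
    show "\<forall>\<^sub>F n in sequentially. \<forall>x\<in>ball a s. \<forall>h. norm (D n x h - g' x h) \<le> e * norm h"
      if e: "0 < e" for e
    proof -
      obtain N where N: "\<forall>m\<ge>N. \<forall>n\<ge>N. \<forall>x\<in>ball a s. \<forall>v. cmod (D m x v - D n x v) \<le> e * norm v"
        using cauchy[OF e] by blast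
      have "cmod (D n x h - g' x h) \<le> e * norm h" if "n \<ge> N" "x \<in> ball a s" for n x h
      proof (rule Lim_norm_ubound)
        show "(\<lambda>m. D n x h - D m x h) \<longlonglongrightarrow> D n x h - g' x h"
          by (intro tendsto_intros g' that)
        show "\<forall>\<^sub>F m in sequentially. cmod (D n x h - D m x h) \<le> e * norm h"
          using N that unfolding eventually_sequentially by blast
      qed auto
      then show ?thesis unfolding eventually_sequentially by blast
    qed
    show "a \<in> ball a s" using s by simp
    show "(\<lambda>n. f n a) \<longlonglongrightarrow> g a"
      using r1 by (intro tendsto_uniform_limitI[OF r1(2)]) simp
  qed simp
  then obtain g2 where g2: "\<And>x. x \<in> ball a s \<Longrightarrow> (\<lambda>n. f n x) \<longlonglongrightarrow> g2 x"
     "\<And>x. x \<in> ball a s \<Longrightarrow> (g2 has_derivative g' x) (at x within ball a s)" by blast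
  \<comment> \<open>\<open>has_derivative_sequence\<close> delivers some limit function; uniqueness
    of pointwise limits identifies it with \<open>g\<close> on the ball.\<close>
  have "g2 x = g x" if "x \<in> ball a s" for x
  proof -
    have "x \<in> ball a r1" using sub(2)[OF that] s by (meson centre_in_ball subsetD)
    from LIMSEQ_unique[OF g2(1)[OF that] tendsto_uniform_limitI[OF r1(2) this]] show ?thesis .
  qed
  moreover have as: "a \<in> ball a s" using s by simp
  moreover have "(g2 has_derivative g' a) (at a)"
    using g2(2)[OF as] at_within_open[OF as] by simp
  ultimately have "(g has_derivative g' a) (at a)"
    by (metis has_derivative_transform_within_open open_ball)
  moreover have "g' a (c *s v) = c * g' a v" for c v
  proof (rule LIMSEQ_unique[OF g'[OF as]])
    show "(\<lambda>n. D n a (c *s v)) \<longlonglongrightarrow> c * g' a v"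
      unfolding D(2)[OF a] by (intro tendsto_intros g' as)
  qed
  ultimately show "\<exists>D. (g has_derivative D) (at a) \<and> (\<forall>c v. D (c *s v) = c * D v)"
    by blast
qed

section \<open>Identity theorem and maximum principle\<close>

lemma convex_line_preimage:
  fixes S :: "(complex^'n) set"
  assumes "convex S"
  shows "convex {t. a + t *s v \<in> S}"
proof -
  have "linear (\<lambda>t::complex. t *s v)"
    by (rule linearI) (simp_all add: vec_eq_iff algebra_simps)
  moreover have "{t. a + t *s v \<in> S} = (\<lambda>t. t *s v) -` ((\<lambda>x. - a + x) ` S)"
  proof (intro set_eqI iffI)
    fix t assume "t \<in> {t. a + t *s v \<in> S}"
    then show "t \<in> (\<lambda>t. t *s v) -` ((\<lambda>x. - a + x) ` S)"
      by (auto intro!: image_eqI[of _ _ "a + t *s v"])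
  qed auto
  ultimately show ?thesis
    using convex_translation[OF assms, of "- a"] by (simp add: convex_linear_vimage)
qed

lemma open_line_preimage:
  fixes S :: "(complex^'n) set"
  assumes "open S"
  shows "open {t. a + t *s v \<in> S}"
proof -
  have "continuous_on UNIV (\<lambda>t. a + t *s v)"
    using has_derivative_continuous[OF has_derivative_add[OF has_derivative_const has_derivative_smult_left]]
    by (intro continuous_at_imp_continuous_on) blast
  from open_vimage[OF assms this] show ?thesis by (simp add: vimage_def)
qed

text \<open>A complex line joins \<open>y\<close> to \<open>b\<close>; its trace in the ball is
  convex, hence connected, so the one-variable identity theorem carries the vanishing from parameter
  0 to parameter 1.\<close>

lemma holomorphic_Cn_eq_zero_on_ball:
  fixes f :: "complex^'n \<Rightarrow> complex"
  assumes hol: "holomorphic_Cn_on f (ball a r)" and U: "open U" "y \<in> U" "y \<in> ball a r"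
    and zero: "\<And>x. x \<in> U \<Longrightarrow> f x = 0" and b: "b \<in> ball a r"
  shows "f b = 0"
proof -
  define v where "v = b - y"
  define T where "T = {t. y + t *s v \<in> ball a r}"
  define T0 where "T0 = {t. y + t *s v \<in> U} \<inter> T"
  have T: "open T" "connected T" unfolding T_def
    by (intro open_line_preimage convex_connected convex_line_preimage open_ball convex_ball)+
  have T0: "open T0" "0 \<in> T0" unfolding T0_def using T U by (auto intro!: open_line_preimage open_Int) (simp_all add: T_def)
  have hT: "(\<lambda>t. f (y + t *s v)) holomorphic_on T"
    by (rule holomorphic_on_line[OF hol T(1)]) (simp add: T_def)
  have "f (y + 1 *s v) = 0"
  proof (rule analytic_continuation_open[of T0 T "\<lambda>t. f (y + t *s v)" "\<lambda>_. 0"])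
    show "1 \<in> T" using b by (simp add: T_def v_def)
    show "f (y + t *s v) = 0" if "t \<in> T0" for t using zero that by (simp add: T0_def)
    show "T0 \<noteq> {}" using T0(2) by blast
    show "T0 \<subseteq> T" by (auto simp: T0_def)
  qed (use hT T T0 in auto)
  then show ?thesis by (simp add: v_def)
qed

text \<open>The interior of the zero set is open and relatively closed: a ball around a limit point
  meets it, and the ball version then fills that ball.\<close>

lemma identity_theorem_Cn:
  fixes f :: "complex^'n \<Rightarrow> complex"
  assumes S: "open S" "connected S" and hol: "holomorphic_Cn_on f S"
    and U: "open U" "U \<noteq> {}" "U \<subseteq> S" "\<And>x. x \<in> U \<Longrightarrow> f x = 0" and z: "z \<in> S"
  shows "f z = 0"
proof -
  define Z where "Z = interior {x\<in>S. f x = 0}"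
  have "U \<subseteq> Z" unfolding Z_def using U by (intro interior_maximal) auto
  have ZS: "Z \<subseteq> S" unfolding Z_def using interior_subset by blast
  have "closedin (top_of_set S) Z"
  proof -
    have "S \<inter> closure Z \<subseteq> Z"
    proof
      fix x assume x: "x \<in> S \<inter> closure Z"
      obtain r where r: "0 < r" "ball x r \<subseteq> S" using S x open_contains_ball by blast
      obtain y where y: "y \<in> Z" "y \<in> ball x r"
        using x r unfolding closure_approachable mem_ball by (metis IntD2 closure_approachable dist_commute)
      have "f b = 0" if "b \<in> ball x r" for b
        using holomorphic_Cn_eq_zero_on_ball[OF holomorphic_Cn_on_subset[OF hol r(2)] _ y _ that]
          interior_subset Z_def by blast
      then have "ball x r \<subseteq> Z" unfolding Z_def using r by (intro interior_maximal) auto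
      then show "x \<in> Z" using r by auto
    qed
    then have "Z = S \<inter> closure Z" using ZS closure_subset by blast
    then show ?thesis using closedin_closed_Int[OF closed_closure] by metis
  qed
  moreover have "openin (top_of_set S) Z"
    using ZS by (intro open_subset) (auto simp: Z_def)
  ultimately have "Z = S"
    using S(2) U(2) \<open>U \<subseteq> Z\<close> unfolding connected_clopen by blast
  then show ?thesis using z interior_subset unfolding Z_def by blast
qed

lemma mem_ball_smult: "a + t *s v \<in> ball a r \<longleftrightarrow> cmod t * norm v < r" for v :: "complex^'n"
  by (simp add: dist_norm norm_vector_smult)

text \<open>On the line through \<open>a\<close> and \<open>b\<close> the function is not
  identically zero. If nonconstant, it has finitely many zeros in the closed unit disc, so some
  radius in (0, 1] avoids them; if constant, radius 1 does. Rescaling the direction makes this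
  circle |t| = 1.\<close>

lemma exists_circle_avoiding_zeros:
  fixes f :: "complex^'n \<Rightarrow> complex"
  assumes hol: "holomorphic_Cn_on f (ball a r)" and b: "b \<in> ball a r" "f b \<noteq> 0"
  shows "\<exists>v. norm v < r \<and> (\<forall>t. cmod t = 1 \<longrightarrow> f (a + t *s v) \<noteq> 0)"
proof (cases "b = a")
  case True
  have "0 < r" using b(1) zero_le_dist[of a b] by (simp del: zero_le_dist)
  \<comment> \<open>The circle degenerates to the point \<open>a\<close>.\<close>
  then show ?thesis using True b by (intro exI[of _ 0]) simp
next
  case False
  define T where "T = {t. a + t *s (b - a) \<in> ball a r}"
  define g where "g = (\<lambda>t. f (a + t *s (b - a)))"
  have T: "open T" "connected T" unfolding T_def
    by (intro open_line_preimage convex_connected convex_line_preimage open_ball convex_ball)+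
  have gT: "g holomorphic_on T"
    unfolding g_def by (rule holomorphic_on_line[OF hol T(1)]) (simp add: T_def)
  have nb: "norm (b - a) < r" using b by (simp add: dist_norm norm_minus_commute)
  have T1: "t \<in> T" if "cmod t \<le> 1" for t
  proof -
    have "cmod t * norm (b - a) \<le> 1 * norm (b - a)" using that by (intro mult_right_mono) auto
    then show ?thesis using nb unfolding T_def mem_Collect_eq mem_ball_smult by simp
  qed
  have "\<exists>\<rho>. 0 < \<rho> \<and> \<rho> \<le> 1 \<and> (\<forall>t. cmod t = \<rho> \<longrightarrow> g t \<noteq> 0)"
  proof (cases "g constant_on T")
    case True
    have "g t \<noteq> 0" if "cmod t = 1" for t
    proof -
      have "g t = g 1" using True T1[of t] T1[of 1] that unfolding constant_on_def by force
      then show ?thesis using b by (simp add: g_def)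
    qed
    then show ?thesis by (intro exI[of _ 1]) simp
  next
    case False
    have "finite {z\<in>cball 0 1. g z = 0}"
      by (rule holomorphic_compact_finite_zeros[OF gT T _ _ False]) (use T1 in auto)
    then have "finite (cmod ` {z\<in>cball 0 1. g z = 0})" by blast
    moreover have "infinite {0<..(1::real)}" by simp
    ultimately obtain \<rho> where "\<rho> \<in> {0<..1} - cmod ` {z\<in>cball 0 1. g z = 0}"
      by (metis finite_Diff2 finite.emptyI ex_in_conv)
    then show ?thesis by (intro exI[of _ \<rho>]) force
  qed
  then obtain \<rho> where \<rho>: "0 < \<rho>" "\<rho> \<le> 1" "\<And>t. cmod t = \<rho> \<Longrightarrow> g t \<noteq> 0" by blast
  show ?thesis
  proof (intro exI[of _ "of_real \<rho> *s (b - a)"] conjI allI impI)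
    have "\<rho> * norm (b - a) \<le> 1 * norm (b - a)" using \<rho> by (intro mult_right_mono) auto
    then show "norm (of_real \<rho> *s (b - a)) < r"
      using nb \<rho> unfolding norm_vector_smult by simp
    fix t :: complex assume t: "cmod t = 1"
    have "g (t * of_real \<rho>) \<noteq> 0" using t \<rho> by (intro \<rho>) (simp add: norm_mult)
    then show "f (a + t *s (of_real \<rho> *s (b - a))) \<noteq> 0"
      unfolding g_def vector_smult_assoc .
  qed
qed

lemma max_modulus_on_disc_Cn:
  fixes f :: "complex^'n \<Rightarrow> complex"
  assumes hol: "holomorphic_Cn_on f S" and S: "open S" and v: "\<And>t. cmod t \<le> 1 \<Longrightarrow> a + t *s v \<in> S"
    and bd: "\<And>t. cmod t = 1 \<Longrightarrow> cmod (f (a + t *s v)) \<le> B"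
  shows "cmod (f a) \<le> B"
proof -
  define g where "g = (\<lambda>t. f (a + t *s v))"
  have "open {t. a + t *s v \<in> S}" using S by (rule open_line_preimage)
  from holomorphic_on_line[OF hol this]
  have g: "g holomorphic_on {t. a + t *s v \<in> S}" by (simp add: g_def)
  have sub: "cball 0 1 \<subseteq> {t. a + t *s v \<in> S}" using v by auto
  have "cmod (g 0) \<le> B"
  proof (rule maximum_modulus_frontier[where S = "cball 0 1" and f = g and \<xi> = 0])
    show "g holomorphic_on interior (cball 0 1)"
      using g sub interior_subset holomorphic_on_subset by blast
    show "continuous_on (closure (cball 0 1)) g"
      using holomorphic_on_imp_continuous_on[OF g] sub continuous_on_subset by fastforce
  qed (use bd in \<open>auto simp: g_def\<close>)
  then show ?thesis by (simp add: g_def)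
qed

section \<open>Extremal functions\<close>

text \<open>Stated with convergent upper bounds \<open>I n\<close>, the form in which a minimizing
  sequence comes; integrability of the limit is part of the outcome.\<close>

lemma set_integral_Fatou:
  fixes f :: "nat \<Rightarrow> 'a \<Rightarrow> real"
  assumes \<Omega>: "\<Omega> \<in> sets M" and int: "\<And>n. set_integrable M \<Omega> (f n)"
    and nn: "\<And>n x. x \<in> \<Omega> \<Longrightarrow> 0 \<le> f n x" and lim: "\<And>x. x \<in> \<Omega> \<Longrightarrow> (\<lambda>n. f n x) \<longlonglongrightarrow> g x"
    and le: "\<And>n. (LINT x:\<Omega>|M. f n x) \<le> I n" and I: "I \<longlonglongrightarrow> J"
  shows "set_integrable M \<Omega> g" "(LINT x:\<Omega>|M. g x) \<le> J"
proof -
  define F where "F = (\<lambda>n x. indicator \<Omega> x *\<^sub>R f n x)"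
  define G where "G = (\<lambda>x. indicator \<Omega> x *\<^sub>R g x)"
  have intF: "integrable M (F n)" for n using int[of n] by (simp add: set_integrable_def F_def)
  have Fnn: "0 \<le> F n x" for n x using nn by (simp add: F_def indicator_def)
  have limF: "(\<lambda>n. F n x) \<longlonglongrightarrow> G x" for x using lim by (auto simp: F_def G_def indicator_def)
  have Gnn: "0 \<le> G x" for x by (rule LIMSEQ_le_const[OF limF]) (use Fnn in auto)
  have I0: "0 \<le> I n" for n
  proof -
    have "0 \<le> (LINT x:\<Omega>|M. f n x)"
      unfolding set_lebesgue_integral_def
      using Fnn by (intro Bochner_Integration.integral_nonneg) (simp add: F_def)
    then show ?thesis using le[of n] by simp
  qed
  have J0: "0 \<le> J" by (rule LIMSEQ_le_const[OF I]) (use I0 in auto)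
  have measG: "G \<in> borel_measurable M"
    by (rule borel_measurable_LIMSEQ_real[OF limF]) (use intF in auto)
  have "(\<integral>\<^sup>+x. ennreal (G x) \<partial>M) = (\<integral>\<^sup>+x. liminf (\<lambda>n. ennreal (F n x)) \<partial>M)"
    by (intro nn_integral_cong lim_imp_Liminf[symmetric] tendsto_ennrealI limF) simp
  also have "\<dots> \<le> liminf (\<lambda>n. \<integral>\<^sup>+x. ennreal (F n x) \<partial>M)"
    by (intro nn_integral_liminf) (use intF in auto)
  also have "\<dots> \<le> liminf (\<lambda>n. ennreal (I n))"
  proof (intro Liminf_mono always_eventually allI)
    fix n
    have "(\<integral>\<^sup>+x. ennreal (F n x) \<partial>M) = ennreal (\<integral>x. F n x \<partial>M)"
      by (intro nn_integral_eq_integral intF) (use Fnn in auto)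
    also have "\<dots> \<le> ennreal (I n)"
      using le[of n] by (intro ennreal_leI) (simp add: set_lebesgue_integral_def F_def)
    finally show "(\<integral>\<^sup>+x. ennreal (F n x) \<partial>M) \<le> ennreal (I n)" .
  qed
  also have "\<dots> = ennreal J"
    by (intro lim_imp_Liminf tendsto_ennrealI I) simp
  finally have nn_le: "(\<integral>\<^sup>+x. ennreal (G x) \<partial>M) \<le> ennreal J" .
  have intG: "integrable M G"
    using nn_le Gnn measG by (intro integrableI_nonneg) (auto intro: le_less_trans)
  then show "set_integrable M \<Omega> g" by (simp add: set_integrable_def G_def)
  have "ennreal (\<integral>x. G x \<partial>M) \<le> ennreal J"
    using nn_integral_eq_integral[OF intG] Gnn nn_le by simp
  then show "(LINT x:\<Omega>|M. g x) \<le> J"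
    using J0 by (simp add: set_lebesgue_integral_def G_def)
qed

lemma compact_uniform_constant:
  assumes K: "compact K"
    and loc: "\<And>a. a \<in> K \<Longrightarrow> \<exists>U C. open U \<and> a \<in> U \<and> (\<forall>x\<in>U. P C x)"
    and mono: "\<And>C C' x. P C x \<Longrightarrow> C \<le> C' \<Longrightarrow> P C' x"
  shows "\<exists>C::real. \<forall>x\<in>K. P C x"
proof -
  obtain U C where U: "\<And>a. a \<in> K \<Longrightarrow> open (U a)" "\<And>a. a \<in> K \<Longrightarrow> a \<in> U a"
    and C: "\<And>a x. a \<in> K \<Longrightarrow> x \<in> U a \<Longrightarrow> P (C a) x"
    using loc by metis
  obtain T where T: "T \<subseteq> K" "finite T" "K \<subseteq> (\<Union>a\<in>T. U a)"
    by (rule compactE_image[OF K, of K U]) (use U in auto)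
  \<comment> \<open>The sum dominates every local constant and, unlike a maximum, also exists for an
    empty cover.\<close>
  have "P (\<Sum>a\<in>T. \<bar>C a\<bar>) x" if "x \<in> K" for x
  proof -
    obtain a where a: "a \<in> T" "x \<in> U a" using T \<open>x \<in> K\<close> by blast
    have "C a \<le> \<bar>C a\<bar>" by simp
    also have "\<dots> \<le> (\<Sum>a\<in>T. \<bar>C a\<bar>)" using a T by (intro member_le_sum) auto
    finally show ?thesis using C a T mono by blast
  qed
  then show ?thesis by blast
qed

text \<open>The points at distance at least \<open>r\<close> from the complement, written with balls
  so that no distance to a possibly empty set occurs. For r > 0 and bounded open \<Omega> these are
  compact sets exhausting \<Omega>, each with a uniform margin; for r \<le> 0 the ball is empty and
  the set is everything.\<close>

definition depth_set :: "'a::metric_space set \<Rightarrow> real \<Rightarrow> 'a set" where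
  "depth_set \<Omega> r = {x. ball x r \<subseteq> \<Omega>}"

lemma depth_set_ball:
  assumes "x \<in> depth_set \<Omega> (r + s)" "y \<in> ball x s"
  shows "y \<in> depth_set \<Omega> r"
proof -
  have "ball y r \<subseteq> ball x (r + s)"
  proof
    fix u assume "u \<in> ball y r"
    then show "u \<in> ball x (r + s)" using assms(2) dist_triangle[of x u y] by simp
  qed
  then show ?thesis using assms(1) by (auto simp: depth_set_def)
qed

lemma depth_set_antimono: "r \<le> s \<Longrightarrow> depth_set \<Omega> s \<subseteq> depth_set \<Omega> r"
  unfolding depth_set_def using subset_ball by blast

lemma depth_set_subset: "0 < r \<Longrightarrow> depth_set \<Omega> r \<subseteq> \<Omega>"
  unfolding depth_set_def by (auto dest: subsetD[of _ _ x for x])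

lemma closed_depth_set: "closed (depth_set \<Omega> r)"
proof -
  have "open (- depth_set \<Omega> r)"
    unfolding open_dist
  proof
    fix x assume "x \<in> - depth_set \<Omega> r"
    then obtain y where y: "dist x y < r" "y \<notin> \<Omega>"
      unfolding depth_set_def subset_iff mem_ball by blast
    have "x' \<in> - depth_set \<Omega> r" if "dist x' x < r - dist x y" for x'
      using y that dist_triangle[of x' y x] by (auto simp: depth_set_def subset_iff intro!: exI[of _ y])
    then show "\<exists>e>0. \<forall>x'. dist x' x < e \<longrightarrow> x' \<in> - depth_set \<Omega> r"
      using y by (intro exI[of _ "r - dist x y"]) auto
  qed
  then show ?thesis by (simp add: closed_def)
qed

lemma compact_depth_set:
  fixes \<Omega> :: "'a::euclidean_space set"
  assumes "bounded \<Omega>" "0 < r"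
  shows "compact (depth_set \<Omega> r)"
  using closed_depth_set bounded_subset[OF assms(1) depth_set_subset[OF assms(2)]]
  by (simp add: compact_eq_bounded_closed)

lemma compact_subset_depth_set:
  fixes K :: "'a::heine_borel set"
  assumes "compact K" "K \<subseteq> \<Omega>" "open \<Omega>"
  obtains r where "0 < r" "K \<subseteq> depth_set \<Omega> r"
proof (cases "K = {}")
  case False
  obtain r where r: "0 < r" "\<And>x y. x \<in> K \<Longrightarrow> y \<in> - \<Omega> \<Longrightarrow> r \<le> dist x y"
    using separate_compact_closed[OF assms(1), of "- \<Omega>"] assms by blast
  then have "K \<subseteq> depth_set \<Omega> r" by (force simp: depth_set_def)
  then show ?thesis using r that by blast
qed (use that[of 1] in auto)

section \<open>Energies and pointwise bounds\<close>

locale bounded_domain_exponent =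
  fixes \<Omega> :: "(complex^'n) set" and p :: real
  assumes open_domain: "open \<Omega>" and connected_domain: "connected \<Omega>"
    and bounded_domain: "bounded \<Omega>" and exponent: "1 < p"
begin

text \<open>Membership in the Bergman space stripped of extensionality, so that constants, multiples
  and midpoints qualify without being cut off outside the domain.\<close>

definition p_holomorphic :: "(complex^'n \<Rightarrow> complex) \<Rightarrow> bool" where
  "p_holomorphic f \<longleftrightarrow> holomorphic_Cn_on f \<Omega> \<and> set_integrable lebesgue \<Omega> (\<lambda>z. cmod (f z) powr p)"

text \<open>The p-th power of the norm: being an integral, it lets gaps and averages be computed
  pointwise.\<close>

definition energy :: "(complex^'n \<Rightarrow> complex) \<Rightarrow> real" where
  "energy f = (LINT z:\<Omega>|lebesgue. cmod (f z) powr p)"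

definition energy_gap :: "(complex^'n \<Rightarrow> complex) \<Rightarrow> (complex^'n \<Rightarrow> complex) \<Rightarrow> real" where
  "energy_gap f g = (LINT z:\<Omega>|lebesgue. midpoint_gap p (f z) (g z))"

lemma domain_measurable [simp]: "\<Omega> \<in> sets lebesgue"
  using open_domain by (simp add: lborelD)

lemma domain_lmeasurable: "\<Omega> \<in> lmeasurable"
  using bounded_domain open_domain by (rule lmeasurable_open)

lemma Bergman_space_iff: "f \<in> Bergman_space p \<Omega> \<longleftrightarrow> f \<in> extensional \<Omega> \<and> p_holomorphic f"
  by (auto simp: Bergman_space_def p_holomorphic_def)

lemma energy_cong: "(\<And>z. z \<in> \<Omega> \<Longrightarrow> f z = g z) \<Longrightarrow> energy f = energy g"
  unfolding energy_def by (intro set_lebesgue_integral_cong) auto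

lemma p_holomorphic_cong:
  assumes "\<And>z. z \<in> \<Omega> \<Longrightarrow> f z = g z" "p_holomorphic f"
  shows "p_holomorphic g"
  using assms holomorphic_Cn_on_cong[OF open_domain]
    set_integrable_cong[of lebesgue lebesgue \<Omega> \<Omega> "\<lambda>z. cmod (f z) powr p" "\<lambda>z. cmod (g z) powr p"]
  unfolding p_holomorphic_def by auto

lemma energy_nonneg: "0 \<le> energy f"
  unfolding energy_def set_lebesgue_integral_def by (intro Bochner_Integration.integral_nonneg) simp

lemma energy_gap_nonneg: "0 \<le> energy_gap f g"
  unfolding energy_gap_def set_lebesgue_integral_def
  using midpoint_gap_nonneg[OF exponent] by (intro Bochner_Integration.integral_nonneg) simp

lemma p_holomorphic_const: "p_holomorphic (\<lambda>_. c)"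
  using domain_lmeasurable
  by (auto simp: p_holomorphic_def holomorphic_Cn_on_const set_integrable_def fmeasurable_def
      intro!: integrable_mult_left)

lemma p_holomorphic_cmult: "p_holomorphic f \<Longrightarrow> p_holomorphic (\<lambda>z. c * f z)"
  by (simp add: p_holomorphic_def holomorphic_Cn_on_cmult norm_mult powr_mult)

lemma energy_cmult: "energy (\<lambda>z. c * f z) = cmod c powr p * energy f"
  by (simp add: energy_def norm_mult powr_mult)

lemma p_holomorphic_midpoint:
  assumes f: "p_holomorphic f" and g: "p_holomorphic g"
  shows "p_holomorphic (\<lambda>z. (f z + g z) / 2)"
proof -
  have hol: "holomorphic_Cn_on (\<lambda>z. (f z + g z) / 2) \<Omega>"
    using holomorphic_Cn_on_cmult[OF holomorphic_Cn_on_add, of f \<Omega> g "1/2"] assms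
    by (simp add: p_holomorphic_def)
  have "set_integrable lebesgue \<Omega> (\<lambda>z. cmod ((f z + g z) / 2) powr p)"
  proof (rule set_integrable_bound)
    show "set_integrable lebesgue \<Omega> (\<lambda>z. (cmod (f z) powr p + cmod (g z) powr p) / 2)"
      using assms unfolding p_holomorphic_def by (intro set_integrable_divide set_integral_add) auto
    have "continuous_on \<Omega> (\<lambda>z. cmod ((f z + g z) / 2) powr p)"
      using exponent
      by (intro continuous_on_powr' continuous_on_norm holomorphic_Cn_on_imp_continuous_on[OF hol] continuous_intros) auto
    then have "set_borel_measurable borel \<Omega> (\<lambda>z. cmod ((f z + g z) / 2) powr p)"
      using open_domain by (intro set_measurable_continuous_on) auto
    then show "set_borel_measurable lebesgue \<Omega> (\<lambda>z. cmod ((f z + g z) / 2) powr p)"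
      unfolding set_borel_measurable_def by (intro measurable_completion) simp
    \<comment> \<open>The majorant is convexity of the p-th power of the modulus, that is,
      nonnegativity of \<open>midpoint_gap\<close>.\<close>
    show "AE z in lebesgue. z \<in> \<Omega> \<longrightarrow> norm (cmod ((f z + g z) / 2) powr p)
        \<le> norm ((cmod (f z) powr p + cmod (g z) powr p) / 2)"
    proof (intro always_eventually allI impI)
      fix z
      show "norm (cmod ((f z + g z) / 2) powr p) \<le> norm ((cmod (f z) powr p + cmod (g z) powr p) / 2)"
        using midpoint_gap_nonneg[OF exponent, of "f z" "g z"] by (simp add: midpoint_gap_def)
    qed
  qed
  with hol show ?thesis by (simp add: p_holomorphic_def)
qed

lemma midpoint_gap_integrable:
  assumes "p_holomorphic f" "p_holomorphic g"
  shows "set_integrable lebesgue \<Omega> (\<lambda>z. midpoint_gap p (f z) (g z))"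
  using assms p_holomorphic_midpoint[OF assms] unfolding midpoint_gap_def p_holomorphic_def
  by (intro set_integral_diff set_integrable_divide set_integral_add) auto

lemma energy_gap_eq:
  assumes "p_holomorphic f" "p_holomorphic g"
  shows "energy_gap f g = (energy f + energy g) / 2 - energy (\<lambda>z. (f z + g z) / 2)"
proof -
  have int: "set_integrable lebesgue \<Omega> (\<lambda>z. cmod (f z) powr p)" "set_integrable lebesgue \<Omega> (\<lambda>z. cmod (g z) powr p)"
    "set_integrable lebesgue \<Omega> (\<lambda>z. cmod ((f z + g z) / 2) powr p)"
    using assms p_holomorphic_midpoint[OF assms] by (auto simp: p_holomorphic_def)
  have "energy_gap f g = (LINT z:\<Omega>|lebesgue. (cmod (f z) powr p + cmod (g z) powr p) / 2)
      - energy (\<lambda>z. (f z + g z) / 2)"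
    unfolding energy_gap_def energy_def midpoint_gap_def
    by (intro set_integral_diff(2) set_integrable_divide set_integral_add int)
  also have "(LINT z:\<Omega>|lebesgue. (cmod (f z) powr p + cmod (g z) powr p) / 2) = (energy f + energy g) / 2"
    using set_integral_add(2)[OF int(1,2)] by (simp add: energy_def)
  finally show ?thesis .
qed

lemma value_le_energy:
  assumes "0 < r"
  shows "\<exists>C>0. \<forall>f x. p_holomorphic f \<longrightarrow> x \<in> depth_set \<Omega> r \<longrightarrow> cmod (f x) powr p \<le> C * energy f"
proof -
  have p: "0 < p" using exponent by simp
  obtain C where C: "C > 0" and *: "\<And>(f :: complex^'n \<Rightarrow> complex) a c h \<Omega>.
    \<lbrakk>holomorphic_Cn_on f (ball a r); ball a r \<subseteq> \<Omega>; 0 \<le> c;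
    set_integrable lebesgue \<Omega> h; \<forall>x\<in>\<Omega>. 0 \<le> h x;
    \<forall>x\<in>ball a r. c * cmod (f x) powr p \<le> h x\<rbrakk> \<Longrightarrow>
    c * cmod (f a) powr p \<le> C * (LINT x:\<Omega>|lebesgue. h x)"
    by (rule point_value_le_integral[OF assms p], rule that)
  have "cmod (f x) powr p \<le> C * energy f" if "p_holomorphic f" "x \<in> depth_set \<Omega> r" for f x
    using *[of f x \<Omega> 1 "\<lambda>z. cmod (f z) powr p"] that holomorphic_Cn_on_subset
    by (auto simp: p_holomorphic_def depth_set_def energy_def)
  then show ?thesis using C by blast
qed

lemma bounded_by_energy:
  assumes "0 < r"
  shows "\<exists>M>0. \<forall>f x. p_holomorphic f \<longrightarrow> energy f \<le> K \<longrightarrow> x \<in> depth_set \<Omega> r \<longrightarrow> cmod (f x) \<le> M"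
proof -
  obtain C where C: "C > 0"
    "\<And>f x. p_holomorphic f \<Longrightarrow> x \<in> depth_set \<Omega> r \<Longrightarrow> cmod (f x) powr p \<le> C * energy f"
    using value_le_energy[OF assms] by blast
  \<comment> \<open>|K| + 1 keeps \<open>M\<close> positive whatever the sign of
    \<open>K\<close>.\<close>
  define M where "M = (C * (\<bar>K\<bar> + 1)) powr (1 / p)"
  have CK: "0 < C * (\<bar>K\<bar> + 1)" using C by (simp add: add_nonneg_pos)
  have "cmod (f x) \<le> M" if "p_holomorphic f" "energy f \<le> K" "x \<in> depth_set \<Omega> r" for f x
  proof -
    have "cmod (f x) powr p \<le> C * energy f" using C that by blast
    also have "\<dots> \<le> C * (\<bar>K\<bar> + 1)" using C that by (intro mult_left_mono) auto
    finally have "(cmod (f x) powr p) powr (1 / p) \<le> M"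
      unfolding M_def using exponent by (intro powr_mono2) auto
    then show ?thesis using exponent by (simp add: powr_powr)
  qed
  moreover have "M > 0" using CK unfolding M_def powr_gt_zero by linarith
  ultimately show ?thesis by blast
qed

text \<open>Depth 2 * r keeps \<open>ball x r\<close> at depth \<open>r\<close>, where one
  \<open>M\<close> bounds both functions and the crude pointwise bound applies.
  \<open>point_value_le_integral\<close> is then used for f - g with the gap itself as dominating
  function.\<close>

lemma difference_le_energy_gap:
  assumes r: "0 < r"
  shows "\<exists>C>0. \<forall>f g x. p_holomorphic f \<longrightarrow> p_holomorphic g \<longrightarrow> energy f \<le> K \<longrightarrow> energy g \<le> K \<longrightarrow>
    x \<in> depth_set \<Omega> (2 * r) \<longrightarrow> cmod (f x - g x) powr max 2 p \<le> C * energy_gap f g"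
proof -
  obtain M where M: "M > 0"
    "\<And>f x. p_holomorphic f \<Longrightarrow> energy f \<le> K \<Longrightarrow> x \<in> depth_set \<Omega> r \<Longrightarrow> cmod (f x) \<le> M"
    using bounded_by_energy[OF r] by blast
  have q: "0 < max 2 p" by simp
  obtain c where c: "c > 0"
    "\<And>a b. cmod a \<le> M \<Longrightarrow> cmod b \<le> M \<Longrightarrow> c * cmod (a - b) powr max 2 p \<le> midpoint_gap p a b"
    using midpoint_gap_ge_power[OF exponent M(1)] by blast
  obtain C where C: "C > 0" and *: "\<And>(f :: complex^'n \<Rightarrow> complex) a c h \<Omega>.
    \<lbrakk>holomorphic_Cn_on f (ball a r); ball a r \<subseteq> \<Omega>; 0 \<le> c;
    set_integrable lebesgue \<Omega> h; \<forall>x\<in>\<Omega>. 0 \<le> h x;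
    \<forall>x\<in>ball a r. c * cmod (f x) powr max 2 p \<le> h x\<rbrakk> \<Longrightarrow>
    c * cmod (f a) powr max 2 p \<le> C * (LINT x:\<Omega>|lebesgue. h x)"
    by (rule point_value_le_integral[OF r q], rule that)
  have "cmod (f x - g x) powr max 2 p \<le> C / c * energy_gap f g"
    if fg: "p_holomorphic f" "p_holomorphic g" "energy f \<le> K" "energy g \<le> K" and x: "x \<in> depth_set \<Omega> (2 * r)"
    for f g x
  proof -
    have near: "y \<in> depth_set \<Omega> r" if "y \<in> ball x r" for y
      using depth_set_ball[of x \<Omega> r r y] x that by simp
    have sub: "ball x r \<subseteq> \<Omega>" using near depth_set_subset[OF r] by blast
    have "c * cmod (f x - g x) powr max 2 p \<le> C * (LINT z:\<Omega>|lebesgue. midpoint_gap p (f z) (g z))"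
    proof (rule *)
      show "holomorphic_Cn_on (\<lambda>x. f x - g x) (ball x r)"
        using fg holomorphic_Cn_on_subset[OF _ sub]
        by (intro holomorphic_Cn_on_diff) (auto simp: p_holomorphic_def)
      show "set_integrable lebesgue \<Omega> (\<lambda>z. midpoint_gap p (f z) (g z))"
        by (rule midpoint_gap_integrable) fact+
    qed (use sub c M near fg midpoint_gap_nonneg[OF exponent] in auto)
    then show ?thesis using c by (simp add: energy_gap_def field_simps)
  qed
  then show ?thesis using C c by (intro exI[of _ "C / c"]) auto
qed


section \<open>Existence and uniqueness of the minimizer\<close>

lemma exists_depth:
  assumes "a \<in> \<Omega>"
  obtains r where "0 < r" "a \<in> depth_set \<Omega> r"
  using compact_subset_depth_set[of "{a}" \<Omega>] assms open_domain by auto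

text \<open>Uniform convexity replaces a compactness argument: midpoints have energy at least
  \<open>I\<close>, so the gaps tend to 0 and the sequence is uniformly Cauchy on depth sets. Fatou
  keeps the energy of the limit at most \<open>I\<close>.\<close>

lemma minimizing_sequence_limit:
  assumes hol: "\<And>n. p_holomorphic (g n)" and en: "\<And>n. energy (g n) < I + 1 / (real n + 1)"
    and mid: "\<And>m n. I \<le> energy (\<lambda>x. (g m x + g n x) / 2)"
  shows "\<exists>f. p_holomorphic f \<and> energy f \<le> I \<and> (\<forall>x\<in>\<Omega>. (\<lambda>n. g n x) \<longlonglongrightarrow> f x)"
proof -
  have enK: "energy (g n) \<le> I + 1" for n
  proof -
    have "1 / (real n + 1) \<le> 1" by (simp add: field_simps)
    then show ?thesis using en[of n] by linarith
  qed
  have gap: "energy_gap (g m) (g n) \<le> 1 / (real N + 1)" if "N \<le> m" "N \<le> n" for m n N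
  proof -
    have "1 / (real m + 1) \<le> 1 / (real N + 1)" "1 / (real n + 1) \<le> 1 / (real N + 1)"
      using that by (auto intro!: divide_left_mono)
    then show ?thesis
      using energy_gap_eq[OF hol hol, of m n] en[of m] en[of n] mid[of m n] by argo
  qed
  have cauchy: "uniformly_Cauchy_on (depth_set \<Omega> (2 * r)) g" if r: "0 < r" for r
    unfolding uniformly_Cauchy_on_def
  proof (intro allI impI)
    fix e :: real assume e: "0 < e"
    obtain C where C: "C > 0" "\<And>f g x. p_holomorphic f \<Longrightarrow> p_holomorphic g \<Longrightarrow> energy f \<le> I + 1 \<Longrightarrow>
        energy g \<le> I + 1 \<Longrightarrow> x \<in> depth_set \<Omega> (2 * r) \<Longrightarrow> cmod (f x - g x) powr max 2 p \<le> C * energy_gap f g"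
      using difference_le_energy_gap[OF r] by metis
    obtain N :: nat where N: "C / e powr max 2 p < real N" using reals_Archimedean2 by blast
    have "dist (g m x) (g n x) < e" if "x \<in> depth_set \<Omega> (2 * r)" "N \<le> m" "N \<le> n" for x m n
    proof -
      have "cmod (g m x - g n x) powr max 2 p \<le> C * energy_gap (g m) (g n)"
        using C hol enK that by blast
      also have "\<dots> \<le> C * (1 / (real N + 1))"
        using gap[OF that(2,3)] C by (intro mult_left_mono) auto
      also have "\<dots> < e powr max 2 p"
      proof -
        have "C < real N * e powr max 2 p" using N e by (simp add: field_simps)
        also have "\<dots> \<le> (real N + 1) * e powr max 2 p" by (intro mult_right_mono) auto
        finally show ?thesis by (simp add: field_simps)
      qed
      finally show ?thesis
        using powr_mono2[of "max 2 p" e "cmod (g m x - g n x)"] e by (force simp: dist_norm)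
    qed
    then show "\<exists>M. \<forall>x\<in>depth_set \<Omega> (2 * r). \<forall>m\<ge>M. \<forall>n\<ge>M. dist (g m x) (g n x) < e" by blast
  qed
  define f where "f = (\<lambda>x. lim (\<lambda>n. g n x))"
  have unif: "uniform_limit (depth_set \<Omega> (2 * r)) g f sequentially" if "0 < r" for r
    using Cauchy_uniformly_convergent[OF cauchy[OF that]]
    by (simp add: uniformly_convergent_uniform_limit_iff f_def)
  have lim: "(\<lambda>n. g n x) \<longlonglongrightarrow> f x" if x: "x \<in> \<Omega>" for x
  proof -
    obtain r where r: "0 < r" "x \<in> depth_set \<Omega> r" using exists_depth[OF x] .
    then show ?thesis using unif[of "r / 2"] by (intro tendsto_uniform_limitI) auto
  qed
  have "holomorphic_Cn_on f \<Omega>"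
  proof (rule holomorphic_Cn_on_locally_uniform_limit[OF open_domain])
    show "holomorphic_Cn_on (g n) \<Omega>" for n using hol by (simp add: p_holomorphic_def)
    fix a assume "a \<in> \<Omega>"
    then obtain r where r: "0 < r" "a \<in> depth_set \<Omega> r" by (rule exists_depth)
    have "ball a (r / 2) \<subseteq> depth_set \<Omega> (2 * (r / 4))"
      using depth_set_ball[of a \<Omega> "r / 2" "r / 2"] r by auto
    then show "\<exists>r>0. uniform_limit (ball a r) g f sequentially"
      using uniform_limit_on_subset[OF unif[of "r / 4"]] r by (intro exI[of _ "r / 2"]) simp
  qed
  moreover have I_lim: "(\<lambda>n. I + 1 / (real n + 1)) \<longlonglongrightarrow> I"
    using tendsto_add[OF tendsto_const LIMSEQ_inverse_real_of_nat, of I]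
    by (simp add: inverse_eq_divide add.commute)
  moreover have Fatou_prems:
    "(\<lambda>n. cmod (g n x) powr p) \<longlonglongrightarrow> cmod (f x) powr p" if "x \<in> \<Omega>" for x
    using exponent by (intro tendsto_powr' tendsto_norm lim that tendsto_const) simp
  have "set_integrable lebesgue \<Omega> (\<lambda>z. cmod (f z) powr p)" "energy f \<le> I"
    unfolding energy_def
    by (rule set_integral_Fatou[where f = "\<lambda>n z. cmod (g n z) powr p", OF _ _ _ Fatou_prems _ I_lim];
        use hol en in \<open>auto simp: p_holomorphic_def energy_def intro: less_imp_le\<close>)+
  ultimately show ?thesis using lim unfolding p_holomorphic_def by blast
qed

lemma exists_energy_minimizer:
  assumes z: "z \<in> \<Omega>"
  shows "\<exists>f\<in>Bergman_space p \<Omega>. f z = 1 \<and> (\<forall>g. p_holomorphic g \<longrightarrow> g z = 1 \<longrightarrow> energy f \<le> energy g)"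
proof -
  define S where "S = {energy g | g. p_holomorphic g \<and> g z = 1}"
  define I where "I = Inf S"
  have S: "bdd_below S" "S \<noteq> {}"
    using energy_nonneg p_holomorphic_const[of 1]
    by (auto simp: S_def intro!: bdd_belowI[of _ 0] exI[of _ "\<lambda>_. 1"])
  have I: "I \<le> energy g" if "p_holomorphic g" "g z = 1" for g
    unfolding I_def using S that by (intro cInf_lower) (auto simp: S_def)
  have "\<exists>g. p_holomorphic g \<and> g z = 1 \<and> energy g < I + 1 / (real n + 1)" for n
    using cInf_lessD[OF S(2), of "I + 1 / (real n + 1)"] by (auto simp: S_def I_def)
  then obtain g where g: "\<And>n. p_holomorphic (g n)" "\<And>n. g n z = 1"
    "\<And>n. energy (g n) < I + 1 / (real n + 1)" by metis
  have "I \<le> energy (\<lambda>x. (g m x + g n x) / 2)" for m n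
    by (intro I p_holomorphic_midpoint) (use g in auto)
  from minimizing_sequence_limit[OF g(1,3) this]
  obtain f where f: "p_holomorphic f" "energy f \<le> I" "\<And>x. x \<in> \<Omega> \<Longrightarrow> (\<lambda>n. g n x) \<longlonglongrightarrow> f x" by blast
  have "f z = 1" using LIMSEQ_unique[OF f(3)[OF z]] g(2) by simp
  show ?thesis
  \<comment> \<open>Restriction supplies the extensionality that the Bergman space demands and
    changes nothing on the domain.\<close>
  proof (intro bexI[of _ "restrict f \<Omega>"] conjI allI impI)
    show "restrict f \<Omega> \<in> Bergman_space p \<Omega>"
      using p_holomorphic_cong[OF _ f(1), of "restrict f \<Omega>"] by (simp add: Bergman_space_iff)
    show "restrict f \<Omega> z = 1" using z \<open>f z = 1\<close> by simp
    have "energy (restrict f \<Omega>) = energy f" by (rule energy_cong) simp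
    then show "energy (restrict f \<Omega>) \<le> energy h" if "p_holomorphic h" "h z = 1" for h
      using I[OF that] f(2) by simp
  qed
qed

text \<open>The midpoint competes too, so two minimizers have gap 0, and the gap bounds their
  difference at every point.\<close>

lemma energy_minimizer_unique:
  assumes f: "p_holomorphic f" "f z = 1" and g: "p_holomorphic g" "g z = 1" "energy g = energy f"
    and min: "\<And>h. p_holomorphic h \<Longrightarrow> h z = 1 \<Longrightarrow> energy f \<le> energy h" and x: "x \<in> \<Omega>"
  shows "f x = g x"
proof -
  obtain r where r: "0 < r" "x \<in> depth_set \<Omega> r" using exists_depth[OF x] .
  have "energy f \<le> energy (\<lambda>z. (f z + g z) / 2)"
    by (intro min p_holomorphic_midpoint) (use f g in auto)
  then have "energy_gap f g \<le> 0" using energy_gap_eq[OF f(1) g(1)] g(3) by simp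
  then have "energy_gap f g = 0" using energy_gap_nonneg[of f g] by simp
  moreover obtain C where "cmod (f x - g x) powr max 2 p \<le> C * energy_gap f g"
  proof -
    have "0 < r / 2" "x \<in> depth_set \<Omega> (2 * (r / 2))" "energy f \<le> energy f" "energy g \<le> energy f"
      using r g by auto
    then show thesis using that difference_le_energy_gap[of "r / 2" "energy f"] f(1) g(1) by meson
  qed
  ultimately show ?thesis by simp
qed

lemma Lp_norm_eq: "Lp_norm p \<Omega> f = energy f powr (1 / p)"
  by (simp add: Lp_norm_def energy_def)

lemma energy_eq_Lp_norm: "energy f = Lp_norm p \<Omega> f powr p"
  using exponent energy_nonneg[of f] by (simp add: Lp_norm_eq powr_powr)

text \<open>Evaluates the definite description. Norm and energy have the same minimizers by
  monotonicity of the p-th root, and agreement on the domain is equality of functions because both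
  candidates are extensional.\<close>

lemma minimizer_properties:
  assumes z: "z \<in> \<Omega>"
  shows "p_holomorphic (\<lambda>x. minimizer p \<Omega> x z)" "minimizer p \<Omega> z z = 1"
    "\<And>g. p_holomorphic g \<Longrightarrow> g z = 1 \<Longrightarrow> energy (\<lambda>x. minimizer p \<Omega> x z) \<le> energy g"
    "energy (\<lambda>x. minimizer p \<Omega> x z) = min_norm p \<Omega> z powr p"
proof -
  obtain f where f: "f \<in> Bergman_space p \<Omega>" "f z = 1"
    and min: "\<And>g. p_holomorphic g \<Longrightarrow> g z = 1 \<Longrightarrow> energy f \<le> energy g"
    using exists_energy_minimizer[OF z] by blast
  have "min_norm p \<Omega> z = Lp_norm p \<Omega> f"
    unfolding min_norm_def
  proof (rule cInf_eq_minimum)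
    show "Lp_norm p \<Omega> f \<in> {Lp_norm p \<Omega> f |f. f \<in> Bergman_space p \<Omega> \<and> f z = 1}" using f by blast
    fix y assume "y \<in> {Lp_norm p \<Omega> f |f. f \<in> Bergman_space p \<Omega> \<and> f z = 1}"
    then obtain g where "y = Lp_norm p \<Omega> g" "p_holomorphic g" "g z = 1"
      by (auto simp: Bergman_space_iff)
    then show "Lp_norm p \<Omega> f \<le> y"
      using min[of g] exponent energy_nonneg unfolding Lp_norm_eq by (auto intro: powr_mono2)
  qed
  moreover have "(THE f. f \<in> Bergman_space p \<Omega> \<and> f z = 1 \<and> Lp_norm p \<Omega> f = min_norm p \<Omega> z) = f"
  proof (rule the_equality)
    fix g assume g: "g \<in> Bergman_space p \<Omega> \<and> g z = 1 \<and> Lp_norm p \<Omega> g = min_norm p \<Omega> z"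
    have "f x = g x" if "x \<in> \<Omega>" for x
    proof (rule energy_minimizer_unique[OF _ f(2) _ _ _ min that])
      show "energy g = energy f" using g \<open>min_norm p \<Omega> z = Lp_norm p \<Omega> f\<close> by (simp add: energy_eq_Lp_norm)
    qed (use f g in \<open>auto simp: Bergman_space_iff\<close>)
    then show "g = f" using f g extensionalityI[of g \<Omega> f] by (simp add: Bergman_space_iff)
  qed (use f calculation in auto)
  then have eq: "(\<lambda>x. minimizer p \<Omega> x z) = f" by (simp add: minimizer_def)
  show "p_holomorphic (\<lambda>x. minimizer p \<Omega> x z)" "minimizer p \<Omega> z z = 1"
    "\<And>g. p_holomorphic g \<Longrightarrow> g z = 1 \<Longrightarrow> energy (\<lambda>x. minimizer p \<Omega> x z) \<le> energy g"
    "energy (\<lambda>x. minimizer p \<Omega> x z) = min_norm p \<Omega> z powr p"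
    using f min calculation fun_cong[OF eq, of z] unfolding eq
    by (auto simp: Bergman_space_iff energy_eq_Lp_norm)
qed

section \<open>Competitor inequalities for the extremal functions\<close>

definition extremal :: "complex^'n \<Rightarrow> complex^'n \<Rightarrow> complex" where
  "extremal z x = minimizer p \<Omega> x z"

text \<open>On the domain this is \<open>min_norm\<close> to the power \<open>p\<close>, the
  reciprocal of the diagonal kernel.\<close>

definition min_energy :: "complex^'n \<Rightarrow> real" where
  "min_energy z = energy (extremal z)"

lemma p_holomorphic_extremal: "z \<in> \<Omega> \<Longrightarrow> p_holomorphic (extremal z)"
  and extremal_self: "z \<in> \<Omega> \<Longrightarrow> extremal z z = 1"
  and min_energy_le: "z \<in> \<Omega> \<Longrightarrow> p_holomorphic g \<Longrightarrow> g z = 1 \<Longrightarrow> min_energy z \<le> energy g"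
  and min_energy_eq: "z \<in> \<Omega> \<Longrightarrow> min_energy z = min_norm p \<Omega> z powr p"
  using minimizer_properties unfolding extremal_def[abs_def] min_energy_def by auto

lemma min_energy_nonneg: "0 \<le> min_energy z"
  by (simp add: min_energy_def energy_nonneg)

lemma min_energy_le_energy_1: "z \<in> \<Omega> \<Longrightarrow> min_energy z \<le> energy (\<lambda>_. 1)"
  by (intro min_energy_le p_holomorphic_const) auto

text \<open>Homogeneity: g / g(z) is a competitor at \<open>z\<close> whenever g(z) is
  nonzero.\<close>

lemma min_energy_scaled:
  assumes z: "z \<in> \<Omega>" and g: "p_holomorphic g"
  shows "min_energy z * cmod (g z) powr p \<le> energy g"
proof (cases "g z = 0")
  case False
  have "min_energy z \<le> energy (\<lambda>x. 1 / g z * g x)"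
    by (intro min_energy_le z p_holomorphic_cmult g) (use False in auto)
  also have "\<dots> = energy g / cmod (g z) powr p"
    unfolding energy_cmult by (simp add: norm_divide powr_divide)
  finally show ?thesis using False by (simp add: field_simps)
qed (simp add: energy_nonneg)

lemma min_energy_tangent:
  assumes z: "z \<in> \<Omega>" and g: "p_holomorphic g"
  shows "min_energy z * (1 + p * (Re (g z) - 1)) \<le> energy g"
proof -
  have "min_energy z * (1 + p * (Re (g z) - 1)) \<le> min_energy z * cmod (g z) powr p"
    using powr_ge_tangent_at_1[of p "g z"] exponent min_energy_nonneg by (intro mult_left_mono) auto
  then show ?thesis using min_energy_scaled[OF z g] by linarith
qed

text \<open>The midpoint takes the value (1 + \<open>extremal w z\<close>) / 2 at \<open>z\<close>,
  and symmetrically at \<open>w\<close>. The tangent inequality bounds its energy below once from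
  each base point; the 1/2 in these values and the averaging of the two bounds produce p /
  4.\<close>

lemma energy_gap_extremal_le:
  assumes z: "z \<in> \<Omega>" and w: "w \<in> \<Omega>"
  shows "energy_gap (extremal z) (extremal w) \<le>
    p / 4 * (min_energy z * (1 - Re (extremal w z)) + min_energy w * (1 - Re (extremal z w)))"
proof -
  note hol = p_holomorphic_extremal[OF z] p_holomorphic_extremal[OF w]
  define m where "m = (\<lambda>x. (extremal z x + extremal w x) / 2)"
  have m: "p_holomorphic m" unfolding m_def using hol by (rule p_holomorphic_midpoint)
  have "min_energy z * (1 + p / 2 * (Re (extremal w z) - 1)) \<le> energy m"
    using min_energy_tangent[OF z m] by (simp add: m_def extremal_self z field_simps)
  moreover have "min_energy w * (1 + p / 2 * (Re (extremal z w) - 1)) \<le> energy m"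
    using min_energy_tangent[OF w m] by (simp add: m_def extremal_self w field_simps)
  moreover have "energy_gap (extremal z) (extremal w) = (min_energy z + min_energy w) / 2 - energy m"
    using energy_gap_eq[OF hol] by (simp add: min_energy_def m_def)
  ultimately show ?thesis by (simp add: field_simps)
qed

text \<open>The constant 1 competes at every base point, so all minimal energies are at most its
  energy. Hence one \<open>M\<close> serves all \<open>z\<close>, even near the boundary.\<close>

lemma extremal_bounded:
  assumes "0 < r"
  shows "\<exists>M>0. \<forall>z\<in>\<Omega>. \<forall>x\<in>depth_set \<Omega> r. cmod (extremal z x) \<le> M"
  using bounded_by_energy[OF assms, of "energy (\<lambda>_. 1)"] p_holomorphic_extremal min_energy_le_energy_1
  unfolding min_energy_def by meson

lemma Lipschitz_of_bounded:
  assumes f: "holomorphic_Cn_on f \<Omega>" and bd: "\<And>x. x \<in> depth_set \<Omega> r \<Longrightarrow> cmod (f x) \<le> M" and r: "0 < r"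
    and x: "x \<in> depth_set \<Omega> (2 * r)" and y: "norm (y - x) < r"
  shows "cmod (f y - f x) \<le> 2 * M / r * norm (y - x)"
proof (rule Schwarz_Cn)
  have near: "u \<in> depth_set \<Omega> r" if "u \<in> ball x r" for u
    using depth_set_ball[of x \<Omega> r r u] x that by simp
  then have "ball x r \<subseteq> \<Omega>" using depth_set_subset[OF r] by blast
  then show "holomorphic_Cn_on f (ball x r)" using f holomorphic_Cn_on_subset by blast
  show "cmod (f u) \<le> M" if "u \<in> ball x r" for u using bd near that by blast
  show "y \<in> ball x r" using y by (simp add: dist_norm norm_minus_commute)
qed

lemma extremal_Lipschitz:
  assumes r: "0 < r"
  shows "\<exists>L>0. \<forall>z\<in>\<Omega>. \<forall>x\<in>depth_set \<Omega> (2 * r). \<forall>y. norm (y - x) < r \<longrightarrow>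
    cmod (extremal z y - extremal z x) \<le> L * norm (y - x)"
proof -
  obtain M where M: "M > 0" "\<And>z x. z \<in> \<Omega> \<Longrightarrow> x \<in> depth_set \<Omega> r \<Longrightarrow> cmod (extremal z x) \<le> M"
    using extremal_bounded[OF r] by blast
  have "cmod (extremal z y - extremal z x) \<le> 2 * M / r * norm (y - x)"
    if "z \<in> \<Omega>" "x \<in> depth_set \<Omega> (2 * r)" "norm (y - x) < r" for z x y
    by (rule Lipschitz_of_bounded) (use p_holomorphic_extremal M r that in \<open>auto simp: p_holomorphic_def\<close>)
  then show ?thesis using M r by (intro exI[of _ "2 * M / r"]) auto
qed

section \<open>Dependence on the base point\<close>

text \<open>\<open>extremal z\<close> is close to 1 at \<open>w\<close> by its Lipschitz bound, so
  the tangent inequality at \<open>w\<close> compares the two energies; exchanging the points gives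
  the absolute value.\<close>

lemma min_energy_Lipschitz:
  assumes r: "0 < r"
  shows "\<exists>L>0. \<forall>z\<in>depth_set \<Omega> (2 * r). \<forall>w\<in>depth_set \<Omega> (2 * r). norm (z - w) < r \<longrightarrow>
    \<bar>min_energy z - min_energy w\<bar> \<le> L * norm (z - w)"
proof -
  define V where "V = energy (\<lambda>_. 1)"
  obtain L where L: "L > 0" "\<And>z x y. z \<in> \<Omega> \<Longrightarrow> x \<in> depth_set \<Omega> (2 * r) \<Longrightarrow> norm (y - x) < r \<Longrightarrow>
    cmod (extremal z y - extremal z x) \<le> L * norm (y - x)"
    using extremal_Lipschitz[OF r] by blast
  have V: "0 \<le> V" by (simp add: V_def energy_nonneg)
  have one: "min_energy w - min_energy z \<le> V * p * L * norm (z - w)"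
    if z: "z \<in> depth_set \<Omega> (2 * r)" and w: "w \<in> depth_set \<Omega> (2 * r)" and zw: "norm (z - w) < r" for z w
  proof -
    have \<Omega>: "z \<in> \<Omega>" "w \<in> \<Omega>" using z w depth_set_subset[of "2 * r"] r by auto
    have "1 - Re (extremal z w) = Re (extremal z z - extremal z w)" by (simp add: extremal_self \<Omega>)
    also have "\<dots> \<le> cmod (extremal z z - extremal z w)" by (rule complex_Re_le_cmod)
    also have "\<dots> \<le> L * norm (z - w)" using L \<Omega> w zw by blast
    finally have 1: "1 - Re (extremal z w) \<le> L * norm (z - w)" .
    have "min_energy w * (1 + p * (Re (extremal z w) - 1)) \<le> min_energy z"
      unfolding min_energy_def[of z] by (intro min_energy_tangent p_holomorphic_extremal \<Omega>)
    then have "min_energy w - min_energy z \<le> min_energy w * (p * (1 - Re (extremal z w)))"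
      by (simp add: algebra_simps)
    also have "\<dots> \<le> V * (p * (L * norm (z - w)))"
      using 1 V min_energy_nonneg min_energy_le_energy_1[OF \<Omega>(2)] exponent L
      by (intro order.trans[OF mult_left_mono[OF mult_left_mono[OF 1]] mult_right_mono]) (auto simp: V_def)
    finally show ?thesis by (simp add: mult_ac)
  qed
  have "\<bar>min_energy z - min_energy w\<bar> \<le> (V * p * L + 1) * norm (z - w)"
    if "z \<in> depth_set \<Omega> (2 * r)" "w \<in> depth_set \<Omega> (2 * r)" "norm (z - w) < r" for z w
    using one[OF that] one[of w z] that norm_ge_zero[of "z - w"]
    unfolding distrib_right norm_minus_commute[of w z] by linarith
  moreover have "0 < V * p * L + 1" using V L exponent by (simp add: add_nonneg_pos)
  ultimately show ?thesis by blast
qed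

text \<open>The crude pass: each of the two terms is O(|z - w|), so the gap is as well, and the
  difference is O(|z - w|) to the power 1 / max 2 p. Only continuity is kept, to hold the modulus
  away from 0 on a circle while the base point moves.\<close>

lemma extremal_continuous_in_base_point:
  assumes r: "0 < r" and e: "0 < e"
  shows "\<exists>d>0. \<forall>z\<in>depth_set \<Omega> (2 * r). \<forall>w\<in>depth_set \<Omega> (2 * r). \<forall>x\<in>depth_set \<Omega> (2 * r).
    norm (z - w) < d \<longrightarrow> cmod (extremal z x - extremal w x) \<le> e"
proof -
  define V where "V = energy (\<lambda>_. 1)"
  have V: "0 \<le> V" by (simp add: V_def energy_nonneg)
  obtain L where L: "L > 0" "\<And>z x y. z \<in> \<Omega> \<Longrightarrow> x \<in> depth_set \<Omega> (2 * r) \<Longrightarrow> norm (y - x) < r \<Longrightarrow>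
    cmod (extremal z y - extremal z x) \<le> L * norm (y - x)"
    using extremal_Lipschitz[OF r] by blast
  obtain C where C: "C > 0" "\<And>f g x. p_holomorphic f \<Longrightarrow> p_holomorphic g \<Longrightarrow> energy f \<le> V \<Longrightarrow>
      energy g \<le> V \<Longrightarrow> x \<in> depth_set \<Omega> (2 * r) \<Longrightarrow> cmod (f x - g x) powr max 2 p \<le> C * energy_gap f g"
    using difference_le_energy_gap[OF r, of V] by metis
  define K where "K = C * (p / 4 * (2 * V * L)) + 1"
  have K: "0 < K" using C L V exponent by (simp add: K_def add_nonneg_pos)
  define d where "d = min r (e powr max 2 p / K)"
  have d: "0 < d" using r e K by (simp add: d_def)
  have "cmod (extremal z x - extremal w x) \<le> e"
    if z: "z \<in> depth_set \<Omega> (2 * r)" and w: "w \<in> depth_set \<Omega> (2 * r)" and x: "x \<in> depth_set \<Omega> (2 * r)"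
      and zw: "norm (z - w) < d" for z w x
  proof -
    have \<Omega>: "z \<in> \<Omega>" "w \<in> \<Omega>" using z w depth_set_subset[of "2 * r"] r by auto
    have zwr: "norm (z - w) < r" "norm (w - z) < r" using zw by (auto simp: d_def norm_minus_commute)
    have part: "min_energy a * (1 - Re (extremal b a)) \<le> V * (L * norm (z - w))"
      if ab: "a \<in> \<Omega>" "b \<in> \<Omega>" "a \<in> depth_set \<Omega> (2 * r)" "norm (b - a) < r" "norm (b - a) = norm (z - w)" for a b
    proof -
      have "1 - Re (extremal b a) = Re (extremal b b - extremal b a)" by (simp add: extremal_self ab)
      also have "\<dots> \<le> cmod (extremal b b - extremal b a)" by (rule complex_Re_le_cmod)
      also have "\<dots> \<le> L * norm (z - w)" using L(2)[of b a b] ab by simp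
      finally have 1: "1 - Re (extremal b a) \<le> L * norm (z - w)" .
      show ?thesis
        using V min_energy_nonneg min_energy_le_energy_1[OF ab(1)] L
        by (intro order.trans[OF mult_left_mono[OF 1] mult_right_mono]) (auto simp: V_def)
    qed
    have "min_energy z * (1 - Re (extremal w z)) + min_energy w * (1 - Re (extremal z w)) \<le> 2 * V * L * norm (z - w)"
      using part[OF \<Omega> z zwr(2) norm_minus_commute] part[OF \<Omega>(2,1) w zwr(1) refl] by argo
    then have "p / 4 * (min_energy z * (1 - Re (extremal w z)) + min_energy w * (1 - Re (extremal z w)))
        \<le> p / 4 * (2 * V * L * norm (z - w))"
      using exponent by (intro mult_left_mono) auto
    then have gap: "energy_gap (extremal z) (extremal w) \<le> p / 4 * (2 * V * L * norm (z - w))"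
      using energy_gap_extremal_le[OF \<Omega>] by linarith
    have "cmod (extremal z x - extremal w x) powr max 2 p \<le> C * energy_gap (extremal z) (extremal w)"
      using C(2) p_holomorphic_extremal \<Omega> x min_energy_le_energy_1 unfolding min_energy_def V_def by blast
    also have "\<dots> \<le> C * (p / 4 * (2 * V * L * norm (z - w)))"
      using gap C by (intro mult_left_mono) auto
    also have "\<dots> \<le> K * norm (z - w)" by (simp add: K_def algebra_simps)
    also have "\<dots> \<le> K * (e powr max 2 p / K)"
      using zw K by (intro mult_left_mono) (auto simp: d_def)
    also have "\<dots> = e powr max 2 p" using K by simp
    finally show ?thesis
      using powr_less_mono2[of "max 2 p" e "cmod (extremal z x - extremal w x)"] e by force
  qed
  then show ?thesis using d by blast
qed

section \<open>Quadratic lower bound for the gap\<close>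

text \<open>Connectedness enters here: vanishing on a ball would spread to the base point, where the
  value is 1.\<close>

lemma extremal_not_zero_near:
  assumes z: "z \<in> \<Omega>" and r: "0 < r" "ball a r \<subseteq> \<Omega>"
  shows "\<exists>b\<in>ball a r. extremal z b \<noteq> 0"
proof (rule ccontr)
  assume *: "\<not> ?thesis"
  have "holomorphic_Cn_on (extremal z) \<Omega>" using p_holomorphic_extremal[OF z] by (simp add: p_holomorphic_def)
  then have "extremal z z = 0"
    by (rule identity_theorem_Cn[OF open_domain connected_domain, of "extremal z" "ball a r"])
       (use * r z in auto)
  then show False using extremal_self[OF z] by simp
qed

text \<open>For \<open>p > 2\<close> the gap degenerates at the zeros of \<open>m\<^sub>p(\<cdot>, z)\<close>, but not on a suitable circle around
  any given point; the maximum principle carries the estimate from the circle to its centre.\<close>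
lemma square_difference_le_energy_gap_local:
  assumes z0: "z0 \<in> \<Omega>" and a: "a \<in> \<Omega>"
  shows "\<exists>\<delta>>0. \<exists>C. \<forall>z\<in>ball z0 \<delta>. \<forall>x\<in>ball a \<delta>. \<forall>w\<in>\<Omega>.
    (cmod (extremal z x - extremal w x))\<^sup>2 \<le> C * energy_gap (extremal z) (extremal w)"
proof -
  obtain r0 where r0: "0 < r0" "ball a r0 \<subseteq> \<Omega>" using exists_depth[OF a] by (auto simp: depth_set_def)
  obtain b where b: "b \<in> ball a r0" "extremal z0 b \<noteq> 0" using extremal_not_zero_near[OF z0 r0] by blast
  have hol0: "holomorphic_Cn_on (extremal z0) \<Omega>" using p_holomorphic_extremal[OF z0] by (simp add: p_holomorphic_def)
  obtain v where v: "norm v < r0" "\<And>t. cmod t = 1 \<Longrightarrow> extremal z0 (a + t *s v) \<noteq> 0"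
    using exists_circle_avoiding_zeros[OF holomorphic_Cn_on_subset[OF hol0 r0(2)] b] by blast
  define D where "D = (\<lambda>t. a + t *s v) ` cball 0 1"
  define T where "T = (\<lambda>t. a + t *s v) ` sphere 0 1"
  have cont: "continuous_on A (\<lambda>t. a + t *s v)" for A
    using has_derivative_continuous[OF has_derivative_add[OF has_derivative_const has_derivative_smult_left]]
    by (intro continuous_at_imp_continuous_on) blast
  have D: "compact D" and T: "compact T" "T \<noteq> {}"
    unfolding D_def T_def by (auto intro!: compact_continuous_image cont)
  have TD: "T \<subseteq> D" unfolding T_def D_def by auto
  have D\<Omega>: "D \<subseteq> \<Omega>"
  proof
    fix x assume "x \<in> D"
    then obtain t where t: "cmod t \<le> 1" "x = a + t *s v" by (auto simp: D_def)
    have "cmod t * norm v \<le> 1 * norm v" using t by (intro mult_right_mono) auto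
    then have "x \<in> ball a r0" using v(1) unfolding t(2) mem_ball_smult by simp
    then show "x \<in> \<Omega>" using r0 by blast
  qed
  obtain s' where s': "0 < s'" "insert z0 D \<subseteq> depth_set \<Omega> s'"
    using compact_subset_depth_set[of "insert z0 D" \<Omega>] D D\<Omega> z0 open_domain by auto
  \<comment> \<open>Depth 4 * s for the disc and for \<open>z0\<close> leaves room for displacements
    below 2 * s inside \<open>depth_set \<Omega> (2 * s)\<close>, where the bounds are
    stated.\<close>
  define s where "s = s' / 4"
  have s: "0 < s" and D4: "D \<subseteq> depth_set \<Omega> (4 * s)" and z4: "z0 \<in> depth_set \<Omega> (4 * s)"
    using s' by (auto simp: s_def)
  have "continuous_on T (\<lambda>x. cmod (extremal z0 x))"
    using continuous_on_subset[OF holomorphic_Cn_on_imp_continuous_on[OF hol0]] TD D\<Omega>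
    by (intro continuous_on_norm) blast
  then obtain y0 where y0: "y0 \<in> T" "\<And>y. y \<in> T \<Longrightarrow> cmod (extremal z0 y0) \<le> cmod (extremal z0 y)"
    using continuous_attains_inf[OF T] by blast
  \<comment> \<open>A third of the minimum on the circle: one third may be lost by moving off the
    circle, one by moving the base point from \<open>z0\<close> to \<open>z\<close>, and \<eta>
    remains.\<close>
  define \<eta> where "\<eta> = cmod (extremal z0 y0) / 3"
  have \<eta>: "0 < \<eta>" using y0(1) v(2) by (auto simp: \<eta>_def T_def)
  have low: "3 * \<eta> \<le> cmod (extremal z0 y)" if "y \<in> T" for y using y0(2)[OF that] by (simp add: \<eta>_def)
  obtain L where L: "L > 0" "\<And>z x y. z \<in> \<Omega> \<Longrightarrow> x \<in> depth_set \<Omega> (2 * s) \<Longrightarrow> norm (y - x) < s \<Longrightarrow>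
    cmod (extremal z y - extremal z x) \<le> L * norm (y - x)"
    using extremal_Lipschitz[OF s] by blast
  obtain d where d: "d > 0" "\<And>z w x. z \<in> depth_set \<Omega> (2 * s) \<Longrightarrow> w \<in> depth_set \<Omega> (2 * s) \<Longrightarrow>
    x \<in> depth_set \<Omega> (2 * s) \<Longrightarrow> norm (z - w) < d \<Longrightarrow> cmod (extremal z x - extremal w x) \<le> \<eta>"
    using extremal_continuous_in_base_point[OF s \<eta>] by blast
  obtain M where M: "M > 0" "\<And>z x. z \<in> \<Omega> \<Longrightarrow> x \<in> depth_set \<Omega> (2 * s) \<Longrightarrow> cmod (extremal z x) \<le> M"
    using extremal_bounded[of "2 * s"] s by auto
  obtain c where c: "c > 0" "\<And>a b. cmod a \<le> M \<Longrightarrow> cmod b \<le> M \<Longrightarrow> \<eta> \<le> cmod a \<Longrightarrow>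
      c * (cmod (a - b))\<^sup>2 \<le> midpoint_gap p a b"
    using midpoint_gap_ge_square[OF exponent M(1) \<eta>] by blast
  define \<rho> where "\<rho> = min s (\<eta> / L)"
  have \<rho>: "0 < \<rho>" "\<rho> \<le> s" "L * \<rho> \<le> \<eta>"
    using s \<eta> L by (auto simp: \<rho>_def min_def field_simps)
  have two_pos: "0 < (2::real)" by simp
  have \<rho>2: "0 < \<rho> / 2" using \<rho> by simp
  obtain C where C: "C > 0" and point: "\<And>(f :: complex^'n \<Rightarrow> complex) a c h \<Omega>.
    \<lbrakk>holomorphic_Cn_on f (ball a (\<rho> / 2)); ball a (\<rho> / 2) \<subseteq> \<Omega>; 0 \<le> c;
    set_integrable lebesgue \<Omega> h; \<forall>x\<in>\<Omega>. 0 \<le> h x;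
    \<forall>x\<in>ball a (\<rho> / 2). c * cmod (f x) powr 2 \<le> h x\<rbrakk> \<Longrightarrow>
    c * cmod (f a) powr 2 \<le> C * (LINT x:\<Omega>|lebesgue. h x)"
    by (rule point_value_le_integral[OF \<rho>2 two_pos], rule that)
  \<comment> \<open>Translating the circle from centre \<open>a\<close> to centre \<open>x\<close>
    moves it by less than \<rho> / 2, and a ball of radius \<rho> / 2 around a translated point
    stays within \<rho> of the original circle.\<close>
  define \<delta> where "\<delta> = min (min d s) (\<rho> / 2)"
  have \<delta>: "0 < \<delta>" "\<delta> \<le> d" "\<delta> \<le> s" "\<delta> \<le> \<rho> / 2" using d s \<rho> by (auto simp: \<delta>_def)
  have "(cmod (extremal z x - extremal w x))\<^sup>2 \<le> C / c * energy_gap (extremal z) (extremal w)"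
    if z: "z \<in> ball z0 \<delta>" and x: "x \<in> ball a \<delta>" and w: "w \<in> \<Omega>" for z x w
  proof -
    have E2: "depth_set \<Omega> (2 * s) \<subseteq> \<Omega>" using s by (intro depth_set_subset) simp
    have z2: "z \<in> depth_set \<Omega> (2 * s)" "z0 \<in> depth_set \<Omega> (2 * s)"
      using depth_set_ball[of z0 \<Omega> "2 * s" "2 * s" z] depth_set_antimono[of "2 * s" "4 * s" \<Omega>] z4 z \<delta> s by auto
    have z\<Omega>: "z \<in> \<Omega>" using z2 E2 by blast
    note hol = p_holomorphic_extremal[OF z\<Omega>] p_holomorphic_extremal[OF w]
    have holg: "holomorphic_Cn_on (\<lambda>u. extremal z u - extremal w u) \<Omega>"
      using hol by (intro holomorphic_Cn_on_diff) (auto simp: p_holomorphic_def)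
    have near: "u \<in> depth_set \<Omega> (2 * s)" if "y \<in> D" "u \<in> ball y s" for y u
      using depth_set_ball[of y \<Omega> "2 * s" "2 * s" u] D4 that s by auto
    have big: "\<eta> \<le> cmod (extremal z u)" if y: "y \<in> T" and u: "u \<in> ball y \<rho>" for y u
    proof -
      have u2: "u \<in> depth_set \<Omega> (2 * s)" using near[of y u] y u TD \<rho> by auto
      have y2: "y \<in> depth_set \<Omega> (2 * s)" using near[of y y] y TD s by auto
      have "cmod (extremal z0 u - extremal z0 y) \<le> L * norm (u - y)"
        using u \<rho> by (intro L z0 y2) (simp add: dist_norm norm_minus_commute)
      also have "\<dots> \<le> L * \<rho>" using L u by (intro mult_left_mono) (auto simp: dist_norm norm_minus_commute)
      finally have "cmod (extremal z0 u - extremal z0 y) \<le> \<eta>" using \<rho> by linarith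
      moreover have "cmod (extremal z u - extremal z0 u) \<le> \<eta>"
        using z \<delta> by (intro d z2 u2) (auto simp: dist_norm norm_minus_commute)
      ultimately show ?thesis
        using low[OF y] norm_triangle_ineq2[of "extremal z0 u" "extremal z u"]
          norm_triangle_ineq2[of "extremal z0 y" "extremal z0 u"]
        by (simp add: norm_minus_commute)
    qed
    have circle: "c * (cmod (extremal z y' - extremal w y'))\<^sup>2 \<le> C * energy_gap (extremal z) (extremal w)"
      if y: "y \<in> T" and y': "y' \<in> ball y (\<rho> / 2)" for y y'
    proof -
      have sub: "u \<in> ball y \<rho>" if "u \<in> ball y' (\<rho> / 2)" for u
        using y' that dist_triangle[of y u y'] by simp
      have sub2: "u \<in> depth_set \<Omega> (2 * s)" if "u \<in> ball y' (\<rho> / 2)" for u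
        using near[of y u] sub[OF that] y TD \<rho> by auto
      have sub\<Omega>: "ball y' (\<rho> / 2) \<subseteq> \<Omega>" using sub2 E2 by blast
      have le: "\<forall>u\<in>ball y' (\<rho> / 2). c * cmod (extremal z u - extremal w u) powr 2
            \<le> midpoint_gap p (extremal z u) (extremal w u)"
      proof
        fix u assume u: "u \<in> ball y' (\<rho> / 2)"
        have "c * (cmod (extremal z u - extremal w u))\<^sup>2 \<le> midpoint_gap p (extremal z u) (extremal w u)"
          by (rule c(2)[OF M(2)[OF z\<Omega> sub2[OF u]] M(2)[OF w sub2[OF u]] big[OF y sub[OF u]]])
        then show "c * cmod (extremal z u - extremal w u) powr 2
            \<le> midpoint_gap p (extremal z u) (extremal w u)" by simp
      qed
      have nn: "\<forall>u\<in>\<Omega>. 0 \<le> midpoint_gap p (extremal z u) (extremal w u)"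
        using midpoint_gap_nonneg[OF exponent] by blast
      have "c * cmod (extremal z y' - extremal w y') powr 2
          \<le> C * (LINT u:\<Omega>|lebesgue. midpoint_gap p (extremal z u) (extremal w u))"
        using point[of "\<lambda>u. extremal z u - extremal w u" y' \<Omega> c
            "\<lambda>u. midpoint_gap p (extremal z u) (extremal w u)"]
          holomorphic_Cn_on_subset[OF holg sub\<Omega>] sub\<Omega> less_imp_le[OF c(1)]
          midpoint_gap_integrable[OF hol] nn le by fast
      then show ?thesis by (simp add: energy_gap_def)
    qed
    define B where "B = sqrt (C / c * energy_gap (extremal z) (extremal w))"
    have "cmod (extremal z x - extremal w x) \<le> B"
    proof (rule max_modulus_on_disc_Cn[OF holg open_domain])
      have shift: "x + t *s v \<in> ball (a + t *s v) \<delta>" for t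
        using x by (simp add: dist_norm)
      show "x + t *s v \<in> \<Omega>" if "cmod t \<le> 1" for t
      proof -
        have "a + t *s v \<in> D" using that by (auto simp: D_def)
        moreover have "x + t *s v \<in> ball (a + t *s v) s" using shift[of t] \<delta>(3) by (auto intro: less_le_trans)
        ultimately show ?thesis using near E2 by blast
      qed
      show "cmod (extremal z (x + t *s v) - extremal w (x + t *s v)) \<le> B" if "cmod t = 1" for t
      proof -
        have "a + t *s v \<in> T" using that by (auto simp: T_def)
        moreover have "x + t *s v \<in> ball (a + t *s v) (\<rho> / 2)"
          using shift[of t] \<delta>(4) by (auto intro: less_le_trans)
        ultimately have "c * (cmod (extremal z (x + t *s v) - extremal w (x + t *s v)))\<^sup>2
            \<le> C * energy_gap (extremal z) (extremal w)" by (rule circle)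
        then show ?thesis unfolding B_def using c by (intro real_le_rsqrt) (simp add: field_simps)
      qed
    qed
    then have "(cmod (extremal z x - extremal w x))\<^sup>2 \<le> B\<^sup>2" by (intro power_mono) auto
    also have "B\<^sup>2 = C / c * energy_gap (extremal z) (extremal w)"
      unfolding B_def using C c energy_gap_nonneg by (intro real_sqrt_pow2) (auto intro!: mult_nonneg_nonneg)
    finally show ?thesis .
  qed
  then show ?thesis using \<delta>(1) by blast
qed

text \<open>Compactness in the pair of base point and evaluation point; nonnegativity of the gap
  allows the constant to be enlarged.\<close>

lemma square_difference_le_energy_gap:
  assumes r: "0 < r"
  shows "\<exists>C>0. \<forall>z\<in>depth_set \<Omega> r. \<forall>x\<in>depth_set \<Omega> r. \<forall>w\<in>\<Omega>.
    (cmod (extremal z x - extremal w x))\<^sup>2 \<le> C * energy_gap (extremal z) (extremal w)"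
proof -
  let ?E = "depth_set \<Omega> r"
  let ?P = "\<lambda>C (z, x). \<forall>w\<in>\<Omega>. (cmod (extremal z x - extremal w x))\<^sup>2 \<le> C * energy_gap (extremal z) (extremal w)"
  have mono: "?P C' u" if "?P C u" "C \<le> C'" for C C' u
  proof -
    have "C * energy_gap (extremal z) (extremal w) \<le> C' * energy_gap (extremal z) (extremal w)" for z w
      using that(2) energy_gap_nonneg by (rule mult_right_mono)
    then show ?thesis using that(1) by (auto intro: order.trans)
  qed
  have "\<exists>C. \<forall>u\<in>?E \<times> ?E. ?P C u"
  proof (rule compact_uniform_constant)
    show "compact (?E \<times> ?E)" using compact_depth_set[OF bounded_domain r] by (intro compact_Times)
    fix u assume u: "u \<in> ?E \<times> ?E"
    obtain z0 a where u_eq: "u = (z0, a)" by (cases u)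
    have "z0 \<in> \<Omega>" "a \<in> \<Omega>" using u u_eq depth_set_subset[OF r] by auto
    from square_difference_le_energy_gap_local[OF this]
    obtain \<delta> C where "0 < \<delta>" "\<forall>z\<in>ball z0 \<delta>. \<forall>x\<in>ball a \<delta>. ?P C (z, x)" by auto
    then show "\<exists>U C. open U \<and> u \<in> U \<and> (\<forall>u\<in>U. ?P C u)"
      by (intro exI[of _ "ball z0 \<delta> \<times> ball a \<delta>"] exI[of _ C]) (auto simp: u_eq intro: open_Times)
  qed (rule mono)
  then obtain C where C: "\<forall>u\<in>?E \<times> ?E. ?P C u" by (rule exE)
  have "?P (max C 1) (z, x)" if "z \<in> ?E" "x \<in> ?E" for z x
    by (rule mono[of C]) (use C[rule_format, of "(z, x)"] that in simp_all)
  then have "\<forall>z\<in>?E. \<forall>x\<in>?E. \<forall>w\<in>\<Omega>.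
      (cmod (extremal z x - extremal w x))\<^sup>2 \<le> max C 1 * energy_gap (extremal z) (extremal w)"
    unfolding prod.case by blast
  moreover have "0 < max C 1" by simp
  ultimately show ?thesis by blast
qed


section \<open>Lipschitz dependence on the base point\<close>

lemma extremal_Lipschitz_in_base_point_local:
  assumes r: "0 < r"
  shows "\<exists>K\<ge>0. \<forall>z\<in>depth_set \<Omega> (2 * r). \<forall>w\<in>depth_set \<Omega> (2 * r). \<forall>x\<in>depth_set \<Omega> (2 * r).
    norm (z - w) < r \<longrightarrow> cmod (extremal z x - extremal w x) \<le> K * norm (z - w)"
proof -
  let ?E = "depth_set \<Omega> (2 * r)"
  define V where "V = energy (\<lambda>_. 1)"
  have V: "0 \<le> V" by (simp add: V_def energy_nonneg)
  obtain L where L: "L > 0" "\<And>z x y. z \<in> \<Omega> \<Longrightarrow> x \<in> ?E \<Longrightarrow> norm (y - x) < r \<Longrightarrow>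
    cmod (extremal z y - extremal z x) \<le> L * norm (y - x)"
    using extremal_Lipschitz[OF r] by blast
  obtain L' where L': "L' > 0" "\<And>z w. z \<in> ?E \<Longrightarrow> w \<in> ?E \<Longrightarrow> norm (z - w) < r \<Longrightarrow>
    \<bar>min_energy z - min_energy w\<bar> \<le> L' * norm (z - w)"
    using min_energy_Lipschitz[OF r] by blast
  obtain C where C: "C > 0" "\<And>z x w. z \<in> depth_set \<Omega> r \<Longrightarrow> x \<in> depth_set \<Omega> r \<Longrightarrow> w \<in> \<Omega> \<Longrightarrow>
    (cmod (extremal z x - extremal w x))\<^sup>2 \<le> C * energy_gap (extremal z) (extremal w)"
    using square_difference_le_energy_gap[OF r] by blast
  \<comment> \<open>The coefficients of A * d and d * d in the quadratic inequality
    \<open>quad\<close>.\<close>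
  define \<alpha> \<beta> where "\<alpha> = C * (p / 4) * (V * (2 / r))" and "\<beta> = C * (p / 4) * (L' * L)"
  have \<alpha>\<beta>: "0 \<le> \<alpha>" "0 \<le> \<beta>" using C V L L' r exponent by (auto simp: \<alpha>_def \<beta>_def)
  have "cmod (extremal z x - extremal w x) \<le> (\<alpha> + \<beta> + 1) * norm (z - w)"
    if z: "z \<in> ?E" and w: "w \<in> ?E" and x: "x \<in> ?E" and zw: "norm (z - w) < r" for z w x
  proof -
    define d where "d = norm (z - w)"
    define g where "g = (\<lambda>x. extremal z x - extremal w x)"
    \<comment> \<open>Stands in for the supremum of |g|: it bounds |g| at depth \<open>r\<close>,
      and its square is exactly a multiple of the gap.\<close>
    define A where "A = sqrt (C * energy_gap (extremal z) (extremal w))"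
    have E: "?E \<subseteq> depth_set \<Omega> r" using r by (intro depth_set_antimono) simp
    have \<Omega>: "z \<in> \<Omega>" "w \<in> \<Omega>" using z w E depth_set_subset[OF r] by blast+
    have A2: "A\<^sup>2 = C * energy_gap (extremal z) (extremal w)"
      unfolding A_def using C energy_gap_nonneg by simp
    have A0: "0 \<le> A" unfolding A_def using C energy_gap_nonneg by simp
    have gA: "cmod (g u) \<le> A" if "u \<in> depth_set \<Omega> r" for u
      unfolding A_def g_def using C(2) z w that \<Omega> E by (intro real_le_rsqrt) blast
    have "holomorphic_Cn_on g \<Omega>"
      unfolding g_def using p_holomorphic_extremal \<Omega>
      by (intro holomorphic_Cn_on_diff) (auto simp: p_holomorphic_def)
    \<comment> \<open>The gain: the Schwarz bound for the difference \<open>g\<close> has the factor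
      \<open>A\<close>, where the functions taken separately would give a constant.\<close>
    then have "cmod (g z - g w) \<le> 2 * A / r * d"
      unfolding d_def by (rule Lipschitz_of_bounded[OF _ gA r w zw])
    then have 1: "Re (g z - g w) \<le> 2 * A / r * d" using complex_Re_le_cmod order.trans by blast
    have "cmod (extremal w z - extremal w w) \<le> L * d" unfolding d_def by (intro L \<Omega> w zw)
    then have 2: "\<bar>Re (extremal w w - extremal w z)\<bar> \<le> L * d"
      using abs_Re_le_cmod[of "extremal w w - extremal w z"] by (simp add: norm_minus_commute)
    have 3: "\<bar>min_energy z - min_energy w\<bar> \<le> L' * d" unfolding d_def by (intro L' z w zw)
    have d0: "0 \<le> d" by (simp add: d_def)
    \<comment> \<open>An exact rearrangement, since each extremal function is 1 at its base point.
      With the common weight \<open>min_energy w\<close> the two terms merge into the increment of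
      \<open>g\<close>; the excess weight meets a Lipschitz factor.\<close>
    have "min_energy z * (1 - Re (extremal w z)) + min_energy w * (1 - Re (extremal z w))
        = min_energy w * Re (g z - g w) + (min_energy z - min_energy w) * Re (extremal w w - extremal w z)"
      by (simp add: g_def extremal_self \<Omega> algebra_simps)
    also have "\<dots> \<le> V * (2 * A / r * d) + (L' * d) * (L * d)"
    proof (rule add_mono)
      show "min_energy w * Re (g z - g w) \<le> V * (2 * A / r * d)"
        using 1 min_energy_nonneg min_energy_le_energy_1[OF \<Omega>(2)] A0 d0 r
        by (intro order.trans[OF mult_left_mono[OF 1] mult_right_mono]) (auto simp: V_def)
      have "\<bar>(min_energy z - min_energy w) * Re (extremal w w - extremal w z)\<bar> \<le> (L' * d) * (L * d)"
        unfolding abs_mult using L' d0 by (intro mult_mono 2 3) auto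
      then show "(min_energy z - min_energy w) * Re (extremal w w - extremal w z) \<le> (L' * d) * (L * d)"
        by (rule order.trans[OF abs_ge_self])
    qed
    finally have "energy_gap (extremal z) (extremal w) \<le> p / 4 * (V * (2 * A / r * d) + (L' * d) * (L * d))"
      using energy_gap_extremal_le[OF \<Omega>] exponent
      by (intro order.trans[OF energy_gap_extremal_le[OF \<Omega>]] mult_left_mono) auto
    then have "A\<^sup>2 \<le> C * (p / 4 * (V * (2 * A / r * d) + (L' * d) * (L * d)))"
      unfolding A2 using C by (intro mult_left_mono) auto
    also have "\<dots> = \<alpha> * (A * d) + \<beta> * (d * d)" by (simp add: \<alpha>_def \<beta>_def algebra_simps)
    finally have quad: "A * A \<le> \<alpha> * (A * d) + \<beta> * (d * d)" by (simp add: power2_eq_square)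
    \<comment> \<open>Either A \<le> d already, or d * d \<le> A * d and the quadratic inequality
      can be divided by \<open>A\<close>.\<close>
    have "A \<le> (\<alpha> + \<beta> + 1) * d"
    proof (cases "A \<le> d")
      case True
      have "1 * d \<le> (\<alpha> + \<beta> + 1) * d" using \<alpha>\<beta> d0 by (intro mult_right_mono) auto
      then show ?thesis using True by simp
    next
      case False
      then have "d * d \<le> A * d" using d0 by (intro mult_right_mono) auto
      then have "\<beta> * (d * d) \<le> \<beta> * (A * d)" using \<alpha>\<beta> by (intro mult_left_mono)
      then have "A * A \<le> A * ((\<alpha> + \<beta>) * d)" using quad by (simp add: algebra_simps)
      then have "A \<le> (\<alpha> + \<beta>) * d" using False d0 by simp
      then show ?thesis using d0 by (simp add: algebra_simps)
    qed
    moreover have "cmod (g x) \<le> A" using gA x E by blast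
    ultimately show ?thesis by (simp add: g_def d_def)
  qed
  then show ?thesis using \<alpha>\<beta> by (intro exI[of _ "\<alpha> + \<beta> + 1"]) auto
qed

text \<open>For |z - w| \<ge> r the trivial bound 2 * M is at most (2 * M / r) * |z - w|, which
  lifts the restriction to nearby base points.\<close>

lemma extremal_Lipschitz_in_base_point:
  assumes r: "0 < r"
  shows "\<exists>K\<ge>0. \<forall>z\<in>depth_set \<Omega> (2 * r). \<forall>w\<in>depth_set \<Omega> (2 * r). \<forall>x\<in>depth_set \<Omega> (2 * r).
    cmod (extremal z x - extremal w x) \<le> K * norm (z - w)"
proof -
  let ?E = "depth_set \<Omega> (2 * r)"
  have E: "?E \<subseteq> \<Omega>" using r by (intro depth_set_subset) simp
  obtain K where K: "0 \<le> K" "\<And>z w x. z \<in> ?E \<Longrightarrow> w \<in> ?E \<Longrightarrow> x \<in> ?E \<Longrightarrow> norm (z - w) < r \<Longrightarrow>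
      cmod (extremal z x - extremal w x) \<le> K * norm (z - w)"
    using extremal_Lipschitz_in_base_point_local[OF r] by blast
  obtain M where M: "M > 0" "\<And>z x. z \<in> \<Omega> \<Longrightarrow> x \<in> ?E \<Longrightarrow> cmod (extremal z x) \<le> M"
    using extremal_bounded[of "2 * r"] r by auto
  have "cmod (extremal z x - extremal w x) \<le> max K (2 * M / r) * norm (z - w)"
    if z: "z \<in> ?E" and w: "w \<in> ?E" and x: "x \<in> ?E" for z w x
  proof (cases "norm (z - w) < r")
    case True
    have "K * norm (z - w) \<le> max K (2 * M / r) * norm (z - w)" by (intro mult_right_mono) auto
    then show ?thesis using K(2)[OF z w x True] by linarith
  next
    case False
    have "cmod (extremal z x - extremal w x) \<le> M + M"
      using M(2)[of z x] M(2)[of w x] z w x E norm_triangle_ineq4[of "extremal z x" "extremal w x"]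
      by (meson add_mono order.trans subsetD)
    also have "\<dots> = 2 * M / r * r" using r by simp
    also have "\<dots> \<le> max K (2 * M / r) * norm (z - w)"
      using False r M K(1) by (intro mult_mono) (auto simp: le_max_iff_disj)
    finally show ?thesis .
  qed
  then show ?thesis using K(1) by (intro exI[of _ "max K (2 * M / r)"]) auto
qed

lemma min_energy_Lipschitz_on_depth_set:
  assumes r: "0 < r"
  shows "\<exists>K\<ge>0. \<forall>z\<in>depth_set \<Omega> (2 * r). \<forall>w\<in>depth_set \<Omega> (2 * r).
    \<bar>min_energy z - min_energy w\<bar> \<le> K * norm (z - w)"
proof -
  let ?E = "depth_set \<Omega> (2 * r)"
  define V where "V = energy (\<lambda>_. 1)"
  have V: "0 \<le> V" by (simp add: V_def energy_nonneg)
  have E: "?E \<subseteq> \<Omega>" using r by (intro depth_set_subset) simp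
  obtain L where L: "L > 0" "\<And>z w. z \<in> ?E \<Longrightarrow> w \<in> ?E \<Longrightarrow> norm (z - w) < r \<Longrightarrow>
    \<bar>min_energy z - min_energy w\<bar> \<le> L * norm (z - w)"
    using min_energy_Lipschitz[OF r] by blast
  have "\<bar>min_energy z - min_energy w\<bar> \<le> max L (V / r) * norm (z - w)" if z: "z \<in> ?E" and w: "w \<in> ?E" for z w
  proof (cases "norm (z - w) < r")
    case True
    have "L * norm (z - w) \<le> max L (V / r) * norm (z - w)" by (intro mult_right_mono) auto
    then show ?thesis using L(2)[OF z w True] by linarith
  next
    case False
    have "\<bar>min_energy z - min_energy w\<bar> \<le> V"
      using min_energy_nonneg[of z] min_energy_nonneg[of w] min_energy_le_energy_1[of z]
        min_energy_le_energy_1[of w] z w E unfolding V_def by fastforce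
    also have "\<dots> = V / r * r" using r by simp
    also have "\<dots> \<le> max L (V / r) * norm (z - w)"
      using False r V L by (intro mult_mono) auto
    finally show ?thesis .
  qed
  then show ?thesis using L(1) by (intro exI[of _ "max L (V / r)"]) auto
qed

section \<open>The kernel, and passage to Hoelder bounds\<close>

lemma Bergman_kernel_eq: "w \<in> \<Omega> \<Longrightarrow> Bergman_kernel p \<Omega> z w = extremal w z / of_real (min_energy w)"
  by (simp add: Bergman_kernel_def Bergman_kernel_diag_def extremal_def min_energy_eq powr_minus divide_inverse)

text \<open>A quotient of Lipschitz functions of \<open>w\<close>; what has to be added is a
  positive lower bound on the denominator.\<close>

lemma Bergman_kernel_Lipschitz:
  assumes r: "0 < r"
  shows "\<exists>K\<ge>0. \<forall>z\<in>depth_set \<Omega> (2 * r). \<forall>w\<in>depth_set \<Omega> (2 * r). \<forall>w'\<in>depth_set \<Omega> (2 * r).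
    cmod (Bergman_kernel p \<Omega> z w - Bergman_kernel p \<Omega> z w') \<le> K * norm (w - w')"
proof -
  let ?E = "depth_set \<Omega> (2 * r)"
  have r2: "0 < 2 * r" using r by simp
  have E: "?E \<subseteq> \<Omega>" using r2 by (rule depth_set_subset)
  obtain K where K: "0 \<le> K" "\<And>z w x. z \<in> ?E \<Longrightarrow> w \<in> ?E \<Longrightarrow> x \<in> ?E \<Longrightarrow>
      cmod (extremal z x - extremal w x) \<le> K * norm (z - w)"
    using extremal_Lipschitz_in_base_point[OF r] by blast
  obtain L where L: "0 \<le> L" "\<And>z w. z \<in> ?E \<Longrightarrow> w \<in> ?E \<Longrightarrow> \<bar>min_energy z - min_energy w\<bar> \<le> L * norm (z - w)"
    using min_energy_Lipschitz_on_depth_set[OF r] by blast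
  obtain M where M: "M > 0" "\<And>z x. z \<in> \<Omega> \<Longrightarrow> x \<in> ?E \<Longrightarrow> cmod (extremal z x) \<le> M"
    using extremal_bounded[OF r2] by blast
  obtain C where C: "C > 0" "\<And>f x. p_holomorphic f \<Longrightarrow> x \<in> ?E \<Longrightarrow> cmod (f x) powr p \<le> C * energy f"
    using value_le_energy[OF r2] by blast
  \<comment> \<open>Point evaluation of \<open>extremal w\<close> at its own base point, where it
    equals 1.\<close>
  have pos: "1 \<le> C * min_energy w" if "w \<in> ?E" for w
    using C(2)[of "extremal w" w] that E p_holomorphic_extremal[of w] extremal_self[of w]
    by (auto simp: min_energy_def)
  have "cmod (Bergman_kernel p \<Omega> z w - Bergman_kernel p \<Omega> z w') \<le> (C * K + M * (C * C * L)) * norm (w - w')"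
    if z: "z \<in> ?E" and w: "w \<in> ?E" and w': "w' \<in> ?E" for z w w'
  proof -
    define \<mu> \<nu> where "\<mu> = min_energy w" and "\<nu> = min_energy w'"
    have \<mu>\<nu>: "0 < \<mu>" "0 < \<nu>" "1 / \<mu> \<le> C" "1 / \<nu> \<le> C"
    proof -
      have "0 < C * \<mu>" "0 < C * \<nu>" using pos[OF w] pos[OF w'] unfolding \<mu>_def \<nu>_def by linarith+
      then show "0 < \<mu>" "0 < \<nu>" using C(1) by (auto simp: zero_less_mult_iff)
      then show "1 / \<mu> \<le> C" "1 / \<nu> \<le> C"
        using pos[OF w] pos[OF w'] by (auto simp: \<mu>_def \<nu>_def field_simps)
    qed
    have "Bergman_kernel p \<Omega> z w - Bergman_kernel p \<Omega> z w'
        = (extremal w z - extremal w' z) * of_real (1 / \<mu>) + extremal w' z * of_real ((\<nu> - \<mu>) * (1 / \<mu> * (1 / \<nu>)))"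
    proof -
      have "Bergman_kernel p \<Omega> z w = extremal w z / of_real \<mu>"
        "Bergman_kernel p \<Omega> z w' = extremal w' z / of_real \<nu>"
        using w w' E by (auto simp: Bergman_kernel_eq \<mu>_def \<nu>_def)
      then show ?thesis using \<mu>\<nu> by (simp add: field_simps)
    qed
    also have "cmod \<dots> \<le> cmod (extremal w z - extremal w' z) * (1 / \<mu>) + cmod (extremal w' z) * (\<bar>\<nu> - \<mu>\<bar> * (1 / \<mu> * (1 / \<nu>)))"
      unfolding norm_mult[symmetric]
      using \<mu>\<nu> by (intro order.trans[OF norm_triangle_ineq])
        (simp add: norm_mult norm_divide abs_mult del: of_real_diff of_real_mult)
    also have "\<dots> \<le> (K * norm (w - w')) * C + M * ((L * norm (w - w')) * (C * C))"
    proof (intro add_mono mult_mono)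
      show "cmod (extremal w z - extremal w' z) \<le> K * norm (w - w')" by (intro K w w' z)
      show "cmod (extremal w' z) \<le> M" using M(2) w' z E by blast
      show "\<bar>\<nu> - \<mu>\<bar> \<le> L * norm (w - w')"
        using L(2)[OF w w'] by (simp add: \<mu>_def \<nu>_def abs_minus_commute)
    qed (use \<mu>\<nu> K L M C in auto)
    also have "\<dots> = (C * K + M * (C * C * L)) * norm (w - w')" by (simp add: algebra_simps)
    finally show ?thesis .
  qed
  then show ?thesis using K L M C by (intro exI[of _ "C * K + M * (C * C * L)"]) auto
qed

end

text \<open>Splits d as d powr \<epsilon> * d powr (1 - \<epsilon>) and bounds the first factor by
  \<open>D\<close>. At d = 0 the splitting persists for every \<epsilon>, because 0 powr x = 0 even
  for x = 0.\<close>

lemma Hoelder_of_Lipschitz: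
  fixes a :: real
  assumes "a \<le> K * d" "0 \<le> K" "0 \<le> d" "d \<le> D" "0 < \<epsilon>"
  shows "a \<le> K * D powr \<epsilon> * d powr (1 - \<epsilon>)"
proof -
  have "d = d powr \<epsilon> * d powr (1 - \<epsilon>)"
    using assms(3) by (simp add: powr_add[symmetric])
  also have "\<dots> \<le> D powr \<epsilon> * d powr (1 - \<epsilon>)"
    using assms by (intro mult_right_mono powr_mono2) auto
  finally have "K * d \<le> K * (D powr \<epsilon> * d powr (1 - \<epsilon>))"
    using assms(2) by (rule mult_left_mono)
  then show ?thesis using assms(1) by (simp add: mult.assoc)
qed

theorem theorem1p2:
  fixes \<Omega> :: "(complex^'n) set" and p :: real
  assumes "open \<Omega>" and "connected \<Omega>" and "bounded \<Omega>" and "\<Omega> \<noteq> {}"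
    and "p > 1"
  shows "(\<forall>\<epsilon>>0. \<forall>S. relatively_compact_in S \<Omega> \<longrightarrow>
            (\<exists>C. \<forall>z'\<in>S. \<forall>z\<in>S. \<forall>w\<in>S.
               cmod (minimizer p \<Omega> z' z - minimizer p \<Omega> z' w) \<le> C * norm (z - w) powr (1 - \<epsilon>)))
       \<and> (\<forall>z\<in>\<Omega>. \<forall>\<epsilon>>0. \<forall>S. relatively_compact_in S \<Omega> \<longrightarrow>
            (\<exists>C. \<forall>w\<in>S. \<forall>w'\<in>S.
               cmod (Bergman_kernel p \<Omega> z w - Bergman_kernel p \<Omega> z w') \<le> C * norm (w - w') powr (1 - \<epsilon>)))"
proof -
  interpret bounded_domain_exponent \<Omega> p
    using assms by unfold_locales
  obtain B where B: "\<And>x. x \<in> \<Omega> \<Longrightarrow> norm x \<le> B"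
    using \<open>bounded \<Omega>\<close> by (auto simp: bounded_iff)
  have diam: "norm (z - w) \<le> 2 * B" if "z \<in> \<Omega>" "w \<in> \<Omega>" for z w
    using norm_triangle_ineq4[of z w] B[OF that(1)] B[OF that(2)] by linarith
  \<comment> \<open>The fixed argument \<open>z\<close> of the kernel need not lie in
    \<open>S\<close> but must share its depth set; where no such point is given, any
    \<open>z0\<close> fills the slot.\<close>
  have depth: "\<exists>r>0. insert z S \<subseteq> depth_set \<Omega> (2 * r)" if S: "relatively_compact_in S \<Omega>" and z: "z \<in> \<Omega>" for S z
  proof -
    obtain s where "0 < s" "insert z (closure S) \<subseteq> depth_set \<Omega> s"
      using compact_subset_depth_set[of "insert z (closure S)" \<Omega>] S z \<open>open \<Omega>\<close>
      by (auto simp: relatively_compact_in_def)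
    then show ?thesis using closure_subset[of S] by (intro exI[of _ "s / 2"]) auto
  qed
  obtain z0 where z0: "z0 \<in> \<Omega>" using \<open>\<Omega> \<noteq> {}\<close> by blast
  show ?thesis
  proof (intro conjI allI ballI impI)
    fix \<epsilon> :: real and S assume \<epsilon>: "0 < \<epsilon>" and S: "relatively_compact_in S \<Omega>"
    obtain r where r: "0 < r" "S \<subseteq> depth_set \<Omega> (2 * r)" using depth[OF S z0] by blast
    obtain K where K: "0 \<le> K" "\<And>z w x. z \<in> S \<Longrightarrow> w \<in> S \<Longrightarrow> x \<in> S \<Longrightarrow>
        cmod (extremal z x - extremal w x) \<le> K * norm (z - w)"
      using extremal_Lipschitz_in_base_point[OF r(1)] r(2) by blast
    have "S \<subseteq> \<Omega>" using r depth_set_subset[of "2 * r" \<Omega>] by auto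
    then show "\<exists>C. \<forall>z'\<in>S. \<forall>z\<in>S. \<forall>w\<in>S.
        cmod (minimizer p \<Omega> z' z - minimizer p \<Omega> z' w) \<le> C * norm (z - w) powr (1 - \<epsilon>)"
      unfolding extremal_def[symmetric]
      by (intro exI[of _ "K * (2 * B) powr \<epsilon>"] ballI
          Hoelder_of_Lipschitz[OF K(2) K(1) norm_ge_zero diam \<epsilon>]) auto
  next
    fix z \<epsilon> S assume z: "z \<in> \<Omega>" and \<epsilon>: "0 < (\<epsilon> :: real)" and S: "relatively_compact_in S \<Omega>"
    obtain r where r: "0 < r" "insert z S \<subseteq> depth_set \<Omega> (2 * r)" using depth[OF S z] by blast
    obtain K where K: "0 \<le> K" "\<And>w w'. w \<in> S \<Longrightarrow> w' \<in> S \<Longrightarrow>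
        cmod (Bergman_kernel p \<Omega> z w - Bergman_kernel p \<Omega> z w') \<le> K * norm (w - w')"
      using Bergman_kernel_Lipschitz[OF r(1)] r(2) by blast
    have "S \<subseteq> \<Omega>" using r depth_set_subset[of "2 * r" \<Omega>] by auto
    then show "\<exists>C. \<forall>w\<in>S. \<forall>w'\<in>S.
        cmod (Bergman_kernel p \<Omega> z w - Bergman_kernel p \<Omega> z w') \<le> C * norm (w - w') powr (1 - \<epsilon>)"
      by (intro exI[of _ "K * (2 * B) powr \<epsilon>"] ballI
          Hoelder_of_Lipschitz[OF K(2) K(1) norm_ge_zero diam \<epsilon>]) auto
  qed
qed

end
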